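(* Let $d=2$ and fix an integer $\kappa\ge3$. There are strictly increasing sequences of energies $\{\mathcal{F}_n\}_{n=1}^\infty$ and $\{\mathcal{G}_n\}_{n=1}^\infty$, depending on $\kappa$, such that $$\{\mathcal{F}_n\},\{\mathcal{G}_n\}\subset\left(\cos(\pi/\kappa)+\cos(2\pi/\kappa),\,1+\cos(2\pi/\kappa)\right)\cap\boldsymbol{\Theta}_\kappa(\Delta)$$ and $\mathcal{F}_n\nearrow 1+\cos(2\pi/\kappa)$, $\mathcal{G}_n\nearrow1+\cos(2\pi/\kappa)$ as $n\to\infty$. Moreover $\mathcal{F}_{2n-1},\mathcal{F}_{2n},\mathcal{G}_{2n-1},\mathcal{G}_{2n}\in\boldsymbol{\Theta}_{n,\kappa}(\Delta)$ for all $n\ge1$.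
   Context: $\mathbb{N}^*=\{1,2,\dots\}$. Here $d=2$. On $\mathscr{H}=\ell^2(\mathbb{Z}^d)$ let $(S_i^{\pm1}u)(n)=u(n_1,\dots,n_i\mp1,\dots,n_d)$, $\Delta=\sum_{i=1}^d\frac12(S_i+S_i^{*})$ (so $\sigma(\Delta)=[-d,d]$), and $(N_iu)(n)=n_iu(n)$. For $j,\kappa\in\mathbb{N}^*$ let $A_i(j,\kappa)$ be the closure of the operator $\frac{1}{4\mathrm{i}}\left[(S_i^{j\kappa}-S_i^{-j\kappa})N_i+N_i(S_i^{j\kappa}-S_i^{-j\kappa})\right]$ defined on compactly supported sequences, and $A_{j\kappa}=\sum_{i=1}^dA_i(j,\kappa)$ (self-adjoint). The conjugate operators considered are the self-adjoint linear combinations (finite or infinite) $\mathbb{A}=\sum_{j\ge1}\rho_{j\kappa}A_{j\kappa}$, $\rho_{j\kappa}\in\mathbb{R}$; $[\Delta,\mathrm{i}\mathbb{A}]_\circ$ is the bounded extension to $\mathscr{H}$ of the commutator initially defined on compactly supported sequences. $\boldsymbol{\mu}_\kappa(\Delta)$ is the set of $E\in\sigma(\Delta)$ for which there exist such an $\mathbb{A}$, an open interval $I\ni E$ and $\gamma>0$ with $1_I(\Delta)[\Delta,\mathrm{i}\mathbb{A}]_\circ1_I(\Delta)\ge\gamma1_I(\Delta)$ ($1_I(\Delta)$ is the spectral projection). $\boldsymbol{\Theta}_\kappa(\Delta)=\sigma(\Delta)\setminus\boldsymbol{\mu}_\kappa(\Delta)$. Let $U_n$ be the Chebyshev polynomial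 of the second kind of degree $n$. For $\vec{x}=(x_1,\dots,x_d)\in[-1,1]^d$ let $g_{j\kappa}(\vec{x})=\sum_{i=1}^d(1-x_i^2)U_{j\kappa-1}(x_i)$, and for $E\in\sigma(\Delta)$ let $S_E=\{\vec{x}\in[-1,1]^d: x_1+\dots+x_d=E\}$. For $m\in\mathbb{N}^*$, $E\in\boldsymbol{\Theta}_{m,\kappa}(\Delta)$ iff there exist $\vec{x}_0,\dots,\vec{x}_m\in S_E$ and real numbers $\omega_0,\dots,\omega_{m-1}\le0$ such that $g_{j\kappa}(\vec{x}_m)=\sum_{q=0}^{m-1}\omega_q\,g_{j\kappa}(\vec{x}_q)$ for all $j\in\mathbb{N}^*$. *)

theory Defs
  imports "HOL-Analysis.Analysis" "HOL-Computational_Algebra.Polynomial"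
begin

section \<open>The Hilbert space of square summable functions\<close>

definition ell2 :: "('a \<Rightarrow> complex) set" where
  "ell2 = {u. (\<lambda>n. (cmod (u n))\<^sup>2) summable_on UNIV}"

definition ell2_inner :: "('a \<Rightarrow> complex) \<Rightarrow> ('a \<Rightarrow> complex) \<Rightarrow> complex" where
  "ell2_inner u v = (\<Sum>\<^sub>\<infinity>n. cnj (u n) * v n)"

definition ell2_norm :: "('a \<Rightarrow> complex) \<Rightarrow> real" where
  "ell2_norm u = sqrt (\<Sum>\<^sub>\<infinity>n. (cmod (u n))\<^sup>2)"

definition ell2_tendsto :: "(nat \<Rightarrow> 'a \<Rightarrow> complex) \<Rightarrow> ('a \<Rightarrow> complex) \<Rightarrow> bool" where
  "ell2_tendsto f u \<longleftrightarrow> (\<lambda>k. ell2_norm (\<lambda>n. f k n - u n)) \<longlonglongrightarrow> 0"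

definition compact_supp :: "('a \<Rightarrow> complex) set" where
  "compact_supp = {u. finite {n. u n \<noteq> 0}}"

text \<open>Bounded operators are functions of which only the restriction to
  \<^const>\<open>ell2\<close> is relevant.\<close>

definition bounded_op :: "(('a \<Rightarrow> complex) \<Rightarrow> ('a \<Rightarrow> complex)) \<Rightarrow> bool" where
  "bounded_op T \<longleftrightarrow>
     (\<forall>u\<in>ell2. T u \<in> ell2) \<and>
     (\<forall>u\<in>ell2. \<forall>v\<in>ell2. \<forall>a b. T (\<lambda>n. a * u n + b * v n) = (\<lambda>n. a * T u n + b * T v n)) \<and>
     (\<exists>K. \<forall>u\<in>ell2. ell2_norm (T u) \<le> K * ell2_norm u)"

definition op_le ::
  "(('a \<Rightarrow> complex) \<Rightarrow> ('a \<Rightarrow> complex)) \<Rightarrow> (('a \<Rightarrow> complex) \<Rightarrow> ('a \<Rightarrow> complex)) \<Rightarrow> bool" where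
  "op_le S T \<longleftrightarrow>
     (\<forall>u\<in>ell2. ell2_inner u (\<lambda>n. T u n - S u n) \<in> \<real> \<and>
               0 \<le> Re (ell2_inner u (\<lambda>n. T u n - S u n)))"

definition op_spectrum :: "(('a \<Rightarrow> complex) \<Rightarrow> ('a \<Rightarrow> complex)) \<Rightarrow> complex set" where
  "op_spectrum T =
     {z. \<not> (\<exists>R. bounded_op R \<and>
              (\<forall>u\<in>ell2. R (\<lambda>n. T u n - z * u n) = u \<and>
                        (\<lambda>n. T (R u) n - z * R u n) = u))}"

section \<open>Spectral measures\<close>

definition orth_projection :: "(('a \<Rightarrow> complex) \<Rightarrow> ('a \<Rightarrow> complex)) \<Rightarrow> bool" where
  "orth_projection P \<longleftrightarrow> bounded_op P \<and> (\<forall>u\<in>ell2. P (P u) = P u) \<and>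
     (\<forall>u\<in>ell2. \<forall>v\<in>ell2. ell2_inner u (P v) = ell2_inner (P u) v)"

definition scalar_spectral_measure ::
  "(real set \<Rightarrow> ('a \<Rightarrow> complex) \<Rightarrow> ('a \<Rightarrow> complex)) \<Rightarrow> ('a \<Rightarrow> complex) \<Rightarrow> real measure" where
  "scalar_spectral_measure P u =
     measure_of UNIV (sets borel) (\<lambda>B. ennreal (Re (ell2_inner u (P B u))))"

text \<open>\<open>P\<close> is the projection-valued Borel measure with \<open>T = \<integral> x dP(x)\<close>. By the spectral
  theorem it exists for every bounded self-adjoint \<open>T\<close>, and its values on Borel sets are
  unique as operators on \<^const>\<open>ell2\<close>; thus \<open>P B\<close> is the spectral projection of \<open>T\<close>
  on \<open>B\<close>.\<close>

definition spectral_measure_of ::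
  "(('a \<Rightarrow> complex) \<Rightarrow> ('a \<Rightarrow> complex)) \<Rightarrow>
   (real set \<Rightarrow> ('a \<Rightarrow> complex) \<Rightarrow> ('a \<Rightarrow> complex)) \<Rightarrow> bool" where
  "spectral_measure_of T P \<longleftrightarrow>
     (\<forall>B\<in>sets borel. orth_projection (P B)) \<and>
     (\<forall>u\<in>ell2. P {} u = (\<lambda>n. 0) \<and> P UNIV u = u) \<and>
     (\<forall>B\<in>sets borel. \<forall>C\<in>sets borel. \<forall>u\<in>ell2. P (B \<inter> C) u = P B (P C u)) \<and>
     (\<forall>u\<in>ell2. countably_additive (sets borel) (\<lambda>B. ennreal (Re (ell2_inner u (P B u))))) \<and>
     (\<forall>u\<in>ell2. integrable (scalar_spectral_measure P u) (\<lambda>x. x) \<and>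
        ell2_inner u (T u) = complex_of_real (\<integral>x. x \<partial>scalar_spectral_measure P u))"

section \<open>Unbounded operators, as graphs\<close>

definition op_closure ::
  "(('a \<Rightarrow> complex) \<times> ('a \<Rightarrow> complex)) set \<Rightarrow> (('a \<Rightarrow> complex) \<times> ('a \<Rightarrow> complex)) set" where
  "op_closure G =
     {(u, v). u \<in> ell2 \<and> v \<in> ell2 \<and>
        (\<exists>f g. (\<forall>k. (f k, g k) \<in> G) \<and> ell2_tendsto f u \<and> ell2_tendsto g v)}"

definition op_adjoint ::
  "(('a \<Rightarrow> complex) \<times> ('a \<Rightarrow> complex)) set \<Rightarrow> (('a \<Rightarrow> complex) \<times> ('a \<Rightarrow> complex)) set" where
  "op_adjoint G =
     {(u, v). u \<in> ell2 \<and> v \<in> ell2 \<and> (\<forall>(x, y)\<in>G. ell2_inner u y = ell2_inner v x)}"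

definition self_adjoint_op :: "(('a \<Rightarrow> complex) \<times> ('a \<Rightarrow> complex)) set \<Rightarrow> bool" where
  "self_adjoint_op G \<longleftrightarrow>
     (\<forall>u\<in>ell2. \<forall>e>0. \<exists>v\<in>Domain G. ell2_norm (\<lambda>n. u n - v n) < e) \<and> op_adjoint G = G"

section \<open>The discrete Laplacian and the conjugate operators on the square lattice\<close>

type_synonym lattice_fun = "int ^ 2 \<Rightarrow> complex"

text \<open>\<open>shift i k\<close> is the \<open>k\<close>-th power of the unitary \<open>S\<^sub>i\<close>, whose adjoint is \<open>shift i (-1)\<close>.\<close>

definition shift :: "2 \<Rightarrow> int \<Rightarrow> lattice_fun \<Rightarrow> lattice_fun" where
  "shift i k u = (\<lambda>n. u (n - axis i k))"

definition position :: "2 \<Rightarrow> lattice_fun \<Rightarrow> lattice_fun" where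
  "position i u = (\<lambda>n. of_int (n $ i) * u n)"

definition Laplacian :: "lattice_fun \<Rightarrow> lattice_fun" where
  "Laplacian u = (\<lambda>n. \<Sum>i\<in>UNIV. 1 / 2 * (shift i 1 u n + shift i (-1) u n))"

definition sigma_Laplacian :: "real set" where
  "sigma_Laplacian = {E. complex_of_real E \<in> op_spectrum Laplacian}"

definition shift_diff :: "2 \<Rightarrow> int \<Rightarrow> lattice_fun \<Rightarrow> lattice_fun" where
  "shift_diff i k u = (\<lambda>n. shift i k u n - shift i (- k) u n)"

definition conj_core :: "2 \<Rightarrow> nat \<Rightarrow> nat \<Rightarrow> lattice_fun \<Rightarrow> lattice_fun" where
  "conj_core i j \<kappa> u = (\<lambda>n. 1 / (4 * \<i>) *
     (shift_diff i (int (j * \<kappa>)) (position i u) n + position i (shift_diff i (int (j * \<kappa>)) u) n))"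

definition conj_dir :: "2 \<Rightarrow> nat \<Rightarrow> nat \<Rightarrow> (lattice_fun \<times> lattice_fun) set" where
  "conj_dir i j \<kappa> = op_closure {(u, conj_core i j \<kappa> u) | u. u \<in> compact_supp}"

text \<open>A sum of unbounded operators on the intersection of their domains is in general not closed,
  even when it is essentially self-adjoint; the self-adjoint operators meant here are the
  closures of such sums.\<close>

definition conj_sum :: "nat \<Rightarrow> nat \<Rightarrow> (lattice_fun \<times> lattice_fun) set" where
  "conj_sum j \<kappa> =
     op_closure {(u, \<lambda>n. \<Sum>i\<in>UNIV. w i n) | u w. \<forall>i. (u, w i) \<in> conj_dir i j \<kappa>}"

definition lin_comb :: "(nat \<Rightarrow> real) \<Rightarrow> nat \<Rightarrow> (lattice_fun \<times> lattice_fun) set" where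
  "lin_comb \<rho> \<kappa> =
     {(u, v). u \<in> ell2 \<and> v \<in> ell2 \<and>
        (\<exists>w. (\<forall>j\<ge>1. \<rho> (j * \<kappa>) \<noteq> 0 \<longrightarrow> (u, w j) \<in> conj_sum j \<kappa>) \<and>
             ell2_tendsto (\<lambda>M n. \<Sum>j=1..M. complex_of_real (\<rho> (j * \<kappa>)) * w j n) v)}"

text \<open>The series must converge on compactly supported sequences, which is where the
  commutator is first computed. Finite combinations are those with \<open>\<rho> (j * \<kappa>) = 0\<close> for
  all large \<open>j\<close>.\<close>

definition conjugate_operator ::
  "nat \<Rightarrow> (nat \<Rightarrow> real) \<Rightarrow> (lattice_fun \<times> lattice_fun) set \<Rightarrow> bool" where
  "conjugate_operator \<kappa> \<rho> A \<longleftrightarrow>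
     A = op_closure (lin_comb \<rho> \<kappa>) \<and> compact_supp \<subseteq> Domain (lin_comb \<rho> \<kappa>) \<and>
     self_adjoint_op A"

text \<open>\<open>C\<close> is the bounded extension of \<open>[\<Delta>, iA]\<close>.\<close>

definition Laplacian_commutator ::
  "(lattice_fun \<times> lattice_fun) set \<Rightarrow> (lattice_fun \<Rightarrow> lattice_fun) \<Rightarrow> bool" where
  "Laplacian_commutator A C \<longleftrightarrow> bounded_op C \<and>
     (\<forall>u\<in>compact_supp. \<exists>v w. (u, v) \<in> A \<and> (Laplacian u, w) \<in> A \<and>
        C u = (\<lambda>n. Laplacian (\<lambda>m. \<i> * v m) n - \<i> * w n))"

definition mu_set :: "nat \<Rightarrow> real set" where
  "mu_set \<kappa> =
     {E \<in> sigma_Laplacian. \<exists>\<rho> A C P I \<gamma>.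
        conjugate_operator \<kappa> \<rho> A \<and> Laplacian_commutator A C \<and>
        spectral_measure_of Laplacian P \<and>
        open I \<and> is_interval I \<and> E \<in> I \<and> \<gamma> > 0 \<and>
        op_le (\<lambda>u n. complex_of_real \<gamma> * P I u n) (\<lambda>u. P I (C (P I u)))}"

definition Theta :: "nat \<Rightarrow> real set" where
  "Theta \<kappa> = sigma_Laplacian - mu_set \<kappa>"

section \<open>Thresholds of finite order\<close>

fun chebyshev_U :: "nat \<Rightarrow> real poly" where
  "chebyshev_U 0 = 1"
| "chebyshev_U (Suc 0) = [:0, 2:]"
| "chebyshev_U (Suc (Suc n)) = [:0, 2:] * chebyshev_U (Suc n) - chebyshev_U n"

text \<open>The first argument stands for the product \<open>j * \<kappa>\<close> and is only used when positive.\<close>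

definition g_fun :: "nat \<Rightarrow> real ^ 2 \<Rightarrow> real" where
  "g_fun m x = (\<Sum>i\<in>UNIV. (1 - (x $ i)\<^sup>2) * poly (chebyshev_U (m - 1)) (x $ i))"

definition energy_surface :: "real \<Rightarrow> (real ^ 2) set" where
  "energy_surface E = {x. (\<forall>i. x $ i \<in> {-1..1}) \<and> (\<Sum>i\<in>UNIV. x $ i) = E}"

definition Theta_order :: "nat \<Rightarrow> nat \<Rightarrow> real set" where
  "Theta_order m \<kappa> =
     {E \<in> sigma_Laplacian. \<exists>(x :: nat \<Rightarrow> real ^ 2) (\<omega> :: nat \<Rightarrow> real).
        (\<forall>q\<le>m. x q \<in> energy_surface E) \<and> (\<forall>q<m. \<omega> q \<le> 0) \<and>
        (\<forall>j\<ge>1. g_fun (j * \<kappa>) (x m) = (\<Sum>q<m. \<omega> q * g_fun (j * \<kappa>) (x q)))}"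

end

theory Submission
  imports Defs
begin

text \<open>
Two independent ideas are combined: an obstruction to strict Mourre estimates, and a chain of
points on the energy surface that triggers it.

\<^bold>\<open>The obstruction\<close> (\<open>Theta_order_subset_Theta\<close>). In Fourier variables the Laplacian is
multiplication by \<open>cos \<theta>\<^sub>1 + cos \<theta>\<^sub>2\<close> and the commutator with \<open>i\<bbbA>\<close> is multiplication by the
symbol \<open>G = \<Sum>\<^sub>j \<rho>(j\<kappa>) g(j\<kappa>)\<close>. A strict estimate at \<open>E\<close> forces \<open>G \<ge> \<gamma> > 0\<close> at every point of the
energy surface of \<open>E\<close>, whereas a relation \<open>g(x\<^sub>m) = \<Sum> \<omega>\<^sub>q g(x\<^sub>q)\<close> with \<open>\<omega>\<^sub>q \<le> 0\<close> gives
\<open>G(x\<^sub>m) \<le> 0\<close>. For infinite combinations the pointwise bound needs continuity of \<open>G\<close>, and it is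
available: applying \<open>\<bbbA>\<close> to a unit vector must give a square summable function, so
\<open>\<Sum>\<^sub>j (j \<rho>(j\<kappa>))\<^sup>2\<close> is finite, and \<open>\<Sum>\<^sub>j \<bar>\<rho>(j\<kappa>)\<bar>\<close> is then finite as well (\<open>rho_summable\<close>).
The Fourier transform is replaced by plane waves truncated to large boxes. They are approximate
eigenvectors of all shifts simultaneously, so the quadratic form of the commutator at them tends
to \<open>G(cos \<theta>\<^sub>1, cos \<theta>\<^sub>2)\<close> (\<open>C_form_limit\<close>). They are also approximate eigenvectors of the Laplacian,
hence almost left fixed by its spectral projection on any neighbourhood of \<open>E\<close>
(\<open>spectral_projection_residual\<close>), and the Mourre estimate passes to the limit
(\<open>commutator_symbol_ge\<close>).

\<^bold>\<open>The chains\<close> (\<open>chain_threshold\<close>). Put \<open>\<tau> = \<pi>/\<kappa>\<close> and \<open>S\<^sub>j(a) = sin (j\<kappa>a)\<close>. A coordinate \<open>cos a\<close>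
contributes \<open>sin a \<sqdot> S\<^sub>j(a)\<close> to \<open>g(j\<kappa>)\<close>, and \<open>cos (2\<tau> - a)\<close> contributes \<open>- sin (2\<tau> - a) \<sqdot> S\<^sub>j(a)\<close>.
Start with \<open>a\<^sub>0 = 0\<close> and choose \<open>a\<^sub>q\<^sub>+\<^sub>1\<close> such that \<open>x\<^sub>q = (cos (2\<tau> - a\<^sub>q), cos a\<^sub>q\<^sub>+\<^sub>1)\<close> has energy \<open>E\<close>.
Since \<open>S\<^sub>j(0) = 0\<close>, each \<open>S\<^sub>j(a\<^sub>q)\<close> is, inductively, a combination of \<open>g(x\<^sub>0), \<dots>, g(x\<^sub>q\<^sub>-\<^sub>1)\<close> with nonnegative
coefficients that do not depend on \<open>j\<close>. If the last point involves only \<open>S\<^sub>j(a\<^sub>n)\<close>, its \<open>g\<close> is a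
combination with nonpositive coefficients. This happens in two cases: the second coordinate is
\<open>cos \<tau>\<close>, for which \<open>S\<^sub>j(\<tau>) = 0\<close>, or the point lies on the diagonal.

Write \<open>E = 1 + cos 2\<tau> - \<epsilon>\<close>. The chain angles are continuous and nondecreasing in \<open>\<epsilon>\<close>, so the intermediate
value theorem yields for each \<open>n\<close> a value \<open>edge_gap n\<close> at which the chain ends in the first way
after \<open>n\<close> steps, and strictly between consecutive such values a value \<open>diagonal_gap n\<close> at which it
ends in the second way. As \<open>cos a\<^sub>q\<close> drops by at least \<open>\<epsilon>\<close> in each step, \<open>edge_gap n\<close> tends to zero.
The interlaced sequence of the corresponding energies serves both as \<open>F\<close> and as \<open>G\<close>.
\<close>

section \<open>Square summable functions\<close>

lemma ell2_iff_abs_summable_square: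
  "u \<in> ell2 \<longleftrightarrow> (\<lambda>n. cmod (u n * u n)) summable_on UNIV"
  by (simp add: ell2_def norm_mult power2_eq_square)

lemma ell2_inner_summable:
  assumes "u \<in> ell2" "v \<in> ell2"
  shows "(\<lambda>n. cmod (cnj (u n) * v n)) summable_on UNIV"
  using assms unfolding ell2_iff_abs_summable_square
  by - (rule abs_summable_product, auto simp: norm_mult)

lemma ell2_zero [simp]: "(\<lambda>n. 0) \<in> ell2"
  by (simp add: ell2_def)

lemma ell2_scale [simp]: "u \<in> ell2 \<Longrightarrow> (\<lambda>n. a * u n) \<in> ell2"
  by (auto simp: ell2_def norm_mult power_mult_distrib intro: summable_on_cmult_right)

lemma ell2_add [simp]:
  assumes "u \<in> ell2" "v \<in> ell2"
  shows "(\<lambda>n. u n + v n) \<in> ell2"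
proof -
  have "(\<lambda>n. 2 * (cmod (u n))\<^sup>2 + 2 * (cmod (v n))\<^sup>2) summable_on UNIV"
    using assms by (intro summable_on_add summable_on_cmult_right) (auto simp: ell2_def)
  moreover have "(cmod (u n + v n))\<^sup>2 \<le> 2 * (cmod (u n))\<^sup>2 + 2 * (cmod (v n))\<^sup>2" for n
  proof -
    have "(cmod (u n + v n))\<^sup>2 \<le> (cmod (u n) + cmod (v n))\<^sup>2"
      by (simp add: norm_triangle_ineq power_mono)
    also have "\<dots> \<le> 2 * (cmod (u n))\<^sup>2 + 2 * (cmod (v n))\<^sup>2"
      using sum_squares_bound[of "cmod (u n)" "cmod (v n)"] by (simp add: power2_sum)
    finally show ?thesis .
  qed
  ultimately show ?thesis
    unfolding ell2_def mem_Collect_eq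
    by (rule summable_on_comparison_test) auto
qed

lemma ell2_diff [simp]:
  assumes "u \<in> ell2" "v \<in> ell2"
  shows "(\<lambda>n. u n - v n) \<in> ell2"
  using ell2_add[OF assms(1) ell2_scale[OF assms(2), of "-1"]] by simp

lemma compact_supp_subset_ell2: "compact_supp \<subseteq> ell2"
proof
  fix u :: "'a \<Rightarrow> complex" assume "u \<in> compact_supp"
  then have "finite {n. u n \<noteq> 0}" by (simp add: compact_supp_def)
  then have "(\<lambda>n. (cmod (u n))\<^sup>2) summable_on {n. u n \<noteq> 0}"
    by (rule summable_on_finite)
  then show "u \<in> ell2"
    unfolding ell2_def mem_Collect_eq
    by (rule summable_on_cong_neutral[THEN iffD1, rotated -1]) auto
qed

lemma ell2_inner_cnj: "cnj (ell2_inner u v) = ell2_inner v u"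
  unfolding ell2_inner_def infsum_cnj[symmetric] by (simp add: mult.commute)

lemma ell2_inner_scale_right: "ell2_inner u (\<lambda>n. a * v n) = a * ell2_inner u v"
  unfolding ell2_inner_def infsum_cmult_right'[symmetric] by (simp add: mult_ac)

lemma ell2_inner_scale_left: "ell2_inner (\<lambda>n. a * u n) v = cnj a * ell2_inner u v"
  using arg_cong[OF ell2_inner_scale_right[of v a u], of cnj] by (simp add: ell2_inner_cnj)

lemma ell2_inner_add_right:
  assumes "u \<in> ell2" "v \<in> ell2" "w \<in> ell2"
  shows "ell2_inner u (\<lambda>n. v n + w n) = ell2_inner u v + ell2_inner u w"
  unfolding ell2_inner_def distrib_left
  using assms
  by (intro infsum_add) (rule abs_summable_summable, rule ell2_inner_summable, assumption+)+

lemma ell2_inner_diff_right: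
  assumes "u \<in> ell2" "v \<in> ell2" "w \<in> ell2"
  shows "ell2_inner u (\<lambda>n. v n - w n) = ell2_inner u v - ell2_inner u w"
  using ell2_inner_add_right[OF assms(1,2) ell2_scale[OF assms(3), of "-1"]]
    ell2_inner_scale_right[of u "-1" w] by simp

lemma ell2_inner_add_left:
  assumes "u \<in> ell2" "v \<in> ell2" "w \<in> ell2"
  shows "ell2_inner (\<lambda>n. v n + w n) u = ell2_inner v u + ell2_inner w u"
  using arg_cong[OF ell2_inner_add_right[OF assms], of cnj] by (simp add: ell2_inner_cnj)

lemma ell2_inner_diff_left:
  assumes "u \<in> ell2" "v \<in> ell2" "w \<in> ell2"
  shows "ell2_inner (\<lambda>n. v n - w n) u = ell2_inner v u - ell2_inner w u"
  using arg_cong[OF ell2_inner_diff_right[OF assms], of cnj] by (simp add: ell2_inner_cnj)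

lemmas ell2_inner_linear = ell2_inner_scale_right ell2_inner_scale_left ell2_inner_add_right
  ell2_inner_add_left ell2_inner_diff_right ell2_inner_diff_left

lemma ell2_norm_nonneg [simp]: "0 \<le> ell2_norm u"
  by (simp add: ell2_norm_def infsum_nonneg)

lemma ell2_norm_square: "(ell2_norm u)\<^sup>2 = (\<Sum>\<^sub>\<infinity>n. (cmod (u n))\<^sup>2)"
  by (simp add: ell2_norm_def infsum_nonneg)

lemma ell2_inner_self:
  assumes "u \<in> ell2"
  shows "ell2_inner u u = complex_of_real ((ell2_norm u)\<^sup>2)"
proof -
  have "ell2_inner u u = (\<Sum>\<^sub>\<infinity>n. complex_of_real ((cmod (u n))\<^sup>2))"
    unfolding ell2_inner_def by (simp only: complex_norm_square mult.commute)
  also have "\<dots> = complex_of_real (\<Sum>\<^sub>\<infinity>n. (cmod (u n))\<^sup>2)"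
    using assms by (intro infsumI has_sum_of_real has_sum_infsum) (simp add: ell2_def)
  finally show ?thesis by (simp only: ell2_norm_square)
qed

lemma norm_le_ell2_norm:
  assumes "u \<in> ell2"
  shows "cmod (u n) \<le> ell2_norm u"
proof -
  have "(\<Sum>k\<in>{n}. (cmod (u k))\<^sup>2) \<le> (ell2_norm u)\<^sup>2"
    unfolding ell2_norm_square using assms by (intro finite_sum_le_infsum) (auto simp: ell2_def)
  then show ?thesis by (simp add: power2_le_iff_abs_le)
qed

lemma ell2_norm_eq_0:
  assumes "u \<in> ell2" "ell2_norm u = 0"
  shows "u = (\<lambda>n. 0)"
  using norm_le_ell2_norm[OF assms(1)] assms(2) by auto

lemma ell2_norm_scale: "ell2_norm (\<lambda>n. a * u n) = cmod a * ell2_norm u"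
proof (rule power2_eq_imp_eq)
  show "(ell2_norm (\<lambda>n. a * u n))\<^sup>2 = (cmod a * ell2_norm u)\<^sup>2"
    by (simp add: ell2_norm_square power_mult_distrib norm_mult infsum_cmult_right')
qed auto

lemma L2_set_le_ell2_norm:
  assumes "u \<in> ell2" "finite F"
  shows "L2_set (\<lambda>n. cmod (u n)) F \<le> ell2_norm u"
  unfolding L2_set_def ell2_norm_def
  using assms by (intro real_sqrt_le_mono finite_sum_le_infsum) (auto simp: ell2_def)

lemma ell2_Cauchy_Schwarz:
  assumes "u \<in> ell2" "v \<in> ell2"
  shows "cmod (ell2_inner u v) \<le> ell2_norm u * ell2_norm v"
proof -
  have "cmod (ell2_inner u v) \<le> (\<Sum>\<^sub>\<infinity>n. cmod (cnj (u n) * v n))"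
    unfolding ell2_inner_def by (rule norm_infsum_bound) (rule ell2_inner_summable[OF assms])
  also have "\<dots> \<le> ell2_norm u * ell2_norm v"
  proof (rule infsum_le_finite_sums)
    fix F :: "'a set" assume "finite F"
    have "(\<Sum>n\<in>F. cmod (cnj (u n) * v n)) \<le> L2_set (\<lambda>n. cmod (u n)) F * L2_set (\<lambda>n. cmod (v n)) F"
      using L2_set_mult_ineq[of "\<lambda>n. cmod (u n)" "\<lambda>n. cmod (v n)" F] by (simp add: norm_mult)
    also have "\<dots> \<le> ell2_norm u * ell2_norm v"
      using assms \<open>finite F\<close> by (intro mult_mono L2_set_le_ell2_norm) auto
    finally show "(\<Sum>n\<in>F. cmod (cnj (u n) * v n)) \<le> ell2_norm u * ell2_norm v" .
  qed (rule ell2_inner_summable[OF assms])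
  finally show ?thesis .
qed

lemma ell2_norm_triangle:
  assumes "u \<in> ell2" "v \<in> ell2"
  shows "ell2_norm (\<lambda>n. u n + v n) \<le> ell2_norm u + ell2_norm v"
proof (rule power2_le_imp_le)
  let ?w = "\<lambda>n. u n + v n"
  have "complex_of_real ((ell2_norm ?w)\<^sup>2)
      = ell2_inner u u + ell2_inner u v + (cnj (ell2_inner u v) + ell2_inner v v)"
    using assms by (subst ell2_inner_self[symmetric]) (simp_all add: ell2_inner_linear ell2_inner_cnj)
  from arg_cong[OF this, of Re]
  have "(ell2_norm ?w)\<^sup>2 = (ell2_norm u)\<^sup>2 + 2 * Re (ell2_inner u v) + (ell2_norm v)\<^sup>2"
    using assms by (simp add: ell2_inner_self)
  also have "\<dots> \<le> (ell2_norm u)\<^sup>2 + 2 * (ell2_norm u * ell2_norm v) + (ell2_norm v)\<^sup>2"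
    using ell2_Cauchy_Schwarz[OF assms] complex_Re_le_cmod[of "ell2_inner u v"] by simp
  finally show "(ell2_norm ?w)\<^sup>2 \<le> (ell2_norm u + ell2_norm v)\<^sup>2"
    by (simp add: power2_sum algebra_simps)
qed auto

lemma ell2_sum:
  "finite A \<Longrightarrow> (\<And>k. k \<in> A \<Longrightarrow> u k \<in> ell2) \<Longrightarrow> (\<lambda>n. \<Sum>k\<in>A. u k n) \<in> ell2"
  by (induction A rule: finite_induct) auto

lemma ell2_norm_sum:
  "finite A \<Longrightarrow> (\<And>k. k \<in> A \<Longrightarrow> u k \<in> ell2) \<Longrightarrow>
    ell2_norm (\<lambda>n. \<Sum>k\<in>A. u k n) \<le> (\<Sum>k\<in>A. ell2_norm (u k))"
proof (induction A rule: finite_induct)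
  case empty
  then show ?case by (simp add: ell2_norm_def)
next
  case (insert x A)
  then have "ell2_norm (\<lambda>n. u x n + (\<Sum>k\<in>A. u k n))
      \<le> ell2_norm (u x) + ell2_norm (\<lambda>n. \<Sum>k\<in>A. u k n)"
    by (intro ell2_norm_triangle ell2_sum) auto
  with insert show ?case by simp
qed

lemma ell2_tendsto_pointwise:
  assumes "ell2_tendsto f u" "\<And>k. f k \<in> ell2" "u \<in> ell2"
  shows "(\<lambda>k. f k n) \<longlonglongrightarrow> u n"
proof -
  have "cmod (f k n - u n) \<le> ell2_norm (\<lambda>n. f k n - u n)" for k
    by (rule norm_le_ell2_norm[of "\<lambda>n. f k n - u n"]) (use assms in simp)
  then have "(\<lambda>k. f k n - u n) \<longlonglongrightarrow> 0"
    by (intro Lim_null_comparison[OF always_eventually assms(1)[unfolded ell2_tendsto_def]] allI)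
  then show ?thesis by (simp add: LIM_zero_iff)
qed


section \<open>Approximate eigenvectors and spectral projections\<close>

lemma bounded_op_ell2 [simp]: "bounded_op T \<Longrightarrow> u \<in> ell2 \<Longrightarrow> T u \<in> ell2"
  by (simp add: bounded_op_def)

lemma bounded_op_add:
  assumes "bounded_op T" "u \<in> ell2" "v \<in> ell2"
  shows "T (\<lambda>n. u n + v n) = (\<lambda>n. T u n + T v n)"
proof -
  have "T (\<lambda>n. 1 * u n + 1 * v n) = (\<lambda>n. 1 * T u n + 1 * T v n)"
    using assms unfolding bounded_op_def by blast
  then show ?thesis by simp
qed

lemma bounded_op_diff:
  assumes "bounded_op T" "u \<in> ell2" "v \<in> ell2"
  shows "T (\<lambda>n. u n - v n) = (\<lambda>n. T u n - T v n)"
proof -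
  have "T (\<lambda>n. 1 * u n + (-1) * v n) = (\<lambda>n. 1 * T u n + (-1) * T v n)"
    using assms unfolding bounded_op_def by blast
  then show ?thesis by simp
qed

lemma bounded_op_scale:
  assumes "bounded_op T" "u \<in> ell2"
  shows "T (\<lambda>n. a * u n) = (\<lambda>n. a * T u n)"
proof -
  have "T (\<lambda>n. a * u n + 0 * u n) = (\<lambda>n. a * T u n + 0 * T u n)"
    using assms unfolding bounded_op_def by blast
  then show ?thesis by simp
qed

lemma bounded_op_bound:
  assumes "bounded_op T"
  obtains K where "K > 0" "\<And>u. u \<in> ell2 \<Longrightarrow> ell2_norm (T u) \<le> K * ell2_norm u"
proof -
  obtain K where K: "\<forall>u\<in>ell2. ell2_norm (T u) \<le> K * ell2_norm u"
    using assms unfolding bounded_op_def by blast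
  show thesis
  proof
    show "0 < max K 1" by simp
    show "ell2_norm (T u) \<le> max K 1 * ell2_norm u" if "u \<in> ell2" for u
      using K that mult_right_mono[of K "max K 1" "ell2_norm u"] by fastforce
  qed
qed

locale spectral_resolution =
  fixes T :: "('a \<Rightarrow> complex) \<Rightarrow> ('a \<Rightarrow> complex)"
    and P :: "real set \<Rightarrow> ('a \<Rightarrow> complex) \<Rightarrow> ('a \<Rightarrow> complex)"
  assumes T_bounded: "bounded_op T"
    and T_spectral: "spectral_measure_of T P"
begin

lemma P_bounded: "B \<in> sets borel \<Longrightarrow> bounded_op (P B)"
  using T_spectral by (simp add: spectral_measure_of_def orth_projection_def)

lemma P_ell2 [simp]: "B \<in> sets borel \<Longrightarrow> u \<in> ell2 \<Longrightarrow> P B u \<in> ell2"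
  using P_bounded by simp

lemma P_idem: "B \<in> sets borel \<Longrightarrow> u \<in> ell2 \<Longrightarrow> P B (P B u) = P B u"
  using T_spectral by (simp add: spectral_measure_of_def orth_projection_def)

lemma P_symmetric:
  "B \<in> sets borel \<Longrightarrow> u \<in> ell2 \<Longrightarrow> v \<in> ell2 \<Longrightarrow> ell2_inner u (P B v) = ell2_inner (P B u) v"
  using T_spectral by (simp add: spectral_measure_of_def orth_projection_def)

lemma P_inter:
  "B \<in> sets borel \<Longrightarrow> C \<in> sets borel \<Longrightarrow> u \<in> ell2 \<Longrightarrow> P B (P C u) = P (B \<inter> C) u"
  using T_spectral by (simp add: spectral_measure_of_def)

lemma P_empty: "u \<in> ell2 \<Longrightarrow> P {} u = (\<lambda>n. 0)"
  and P_UNIV: "u \<in> ell2 \<Longrightarrow> P UNIV u = u"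
  using T_spectral by (auto simp: spectral_measure_of_def)

lemma inner_P:
  assumes "B \<in> sets borel" "u \<in> ell2"
  shows "ell2_inner u (P B u) = complex_of_real ((ell2_norm (P B u))\<^sup>2)"
  using P_symmetric[OF assms(1,2) P_ell2[OF assms]] assms
  by (simp add: P_idem ell2_inner_self[OF P_ell2[OF assms]])

lemma sets_scalar_measure [simp]: "sets (scalar_spectral_measure P u) = sets borel"
proof -
  have "sigma_algebra UNIV (sets (borel :: real measure))"
    using sets.sigma_algebra_axioms[of borel] by simp
  then show ?thesis
    by (simp add: scalar_spectral_measure_def sigma_algebra.sigma_sets_eq)
qed

lemma space_scalar_measure [simp]: "space (scalar_spectral_measure P u) = UNIV"
  by (simp add: scalar_spectral_measure_def space_measure_of_conv)

lemma emeasure_scalar_measure: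
  assumes "B \<in> sets borel" "u \<in> ell2"
  shows "emeasure (scalar_spectral_measure P u) B = ennreal ((ell2_norm (P B u))\<^sup>2)"
proof -
  have "emeasure (scalar_spectral_measure P u) B = ennreal (Re (ell2_inner u (P B u)))"
    unfolding scalar_spectral_measure_def
  proof (rule emeasure_measure_of_sigma)
    show "sigma_algebra UNIV (sets (borel :: real measure))"
      using sets.sigma_algebra_axioms[of borel] by simp
    show "positive (sets borel) (\<lambda>B. ennreal (Re (ell2_inner u (P B u))))"
      using assms by (simp add: positive_def P_empty ell2_inner_def)
    show "countably_additive (sets borel) (\<lambda>B. ennreal (Re (ell2_inner u (P B u))))"
      using T_spectral assms by (simp add: spectral_measure_of_def)
  qed (use assms in auto)
  then show ?thesis using assms by (simp add: inner_P)
qed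

lemma finite_scalar_measure:
  assumes "u \<in> ell2"
  shows "finite_measure (scalar_spectral_measure P u)"
  using assms by (intro finite_measureI) (simp add: emeasure_scalar_measure)

lemma measure_scalar_measure:
  assumes "B \<in> sets borel" "u \<in> ell2"
  shows "measure (scalar_spectral_measure P u) B = (ell2_norm (P B u))\<^sup>2"
  using assms by (simp add: measure_def emeasure_scalar_measure)

lemma P_norm_subadditive:
  assumes "B \<in> sets borel" "C \<in> sets borel" "D \<in> sets borel" "B \<subseteq> C \<union> D" "u \<in> ell2"
  shows "(ell2_norm (P B u))\<^sup>2 \<le> (ell2_norm (P C u))\<^sup>2 + (ell2_norm (P D u))\<^sup>2"
proof -
  interpret finite_measure "scalar_spectral_measure P u"
    using assms by (intro finite_scalar_measure)
  have "measure (scalar_spectral_measure P u) B \<le> measure (scalar_spectral_measure P u) (C \<union> D)"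
    using assms by (intro finite_measure_mono) auto
  also have "\<dots> \<le> measure (scalar_spectral_measure P u) C + measure (scalar_spectral_measure P u) D"
    using assms by (intro measure_Un_le) auto
  finally show ?thesis using assms by (simp add: measure_scalar_measure)
qed

lemma P_complement_norm:
  assumes "B \<in> sets borel" "u \<in> ell2"
  shows "(ell2_norm u)\<^sup>2 = (ell2_norm (P B u))\<^sup>2 + (ell2_norm (P (- B) u))\<^sup>2"
proof -
  interpret finite_measure "scalar_spectral_measure P u"
    using assms by (intro finite_scalar_measure)
  have "- B \<in> sets borel" using assms(1) by (simp add: Compl_eq_Diff_UNIV)
  moreover from this have "measure (scalar_spectral_measure P u) (B \<union> - B)
    = measure (scalar_spectral_measure P u) B + measure (scalar_spectral_measure P u) (- B)"
    using assms by (intro finite_measure_Union) auto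
  ultimately show ?thesis using assms by (simp add: measure_scalar_measure P_UNIV)
qed

lemma borel_compl: "B \<in> sets borel \<Longrightarrow> - B \<in> sets (borel :: real measure)"
  by (simp add: Compl_eq_Diff_UNIV)

lemma P_complement_P:
  assumes "B \<in> sets borel" "u \<in> ell2"
  shows "P (- B) (P B u) = (\<lambda>n. 0)" "P B (P (- B) u) = (\<lambda>n. 0)"
  using assms by (simp_all add: P_inter borel_compl P_empty)

text \<open>The definition of a spectral measure requires additivity only of the quadratic forms. Additivity
of the projections follows: with \<open>v = P B u\<close> and \<open>w = P (- B) u\<close>, which are orthogonal, the squared
norm of \<open>u - v - w\<close> expands to zero.\<close>

lemma P_decompose:
  assumes B: "B \<in> sets borel" and u: "u \<in> ell2"
  shows "u = (\<lambda>n. P B u n + P (- B) u n)"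
proof -
  define v w d where "v = P B u" and "w = P (- B) u" and "d = (\<lambda>n. u n - v n - w n)"
  have vw: "v \<in> ell2" "w \<in> ell2" using B u by (auto simp: v_def w_def borel_compl)
  have uu: "ell2_inner u u = ell2_inner v v + ell2_inner w w"
    using arg_cong[OF P_complement_norm[OF B u], of complex_of_real] u vw
    by (simp add: ell2_inner_self flip: v_def w_def)
  have uv: "ell2_inner u v = ell2_inner v v" "ell2_inner u w = ell2_inner w w"
    using inner_P[OF B u] inner_P[OF borel_compl[OF B] u] vw
    by (simp_all add: ell2_inner_self flip: v_def w_def)
  have vu: "ell2_inner v u = ell2_inner v v" "ell2_inner w u = ell2_inner w w"
    using arg_cong[OF uv(1), of cnj] arg_cong[OF uv(2), of cnj] by (simp_all add: ell2_inner_cnj)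
  have "ell2_inner v w = ell2_inner u (\<lambda>n. 0)"
    using P_symmetric[OF B u vw(2)] P_complement_P[OF B u] by (simp add: v_def w_def)
  then have 0: "ell2_inner v w = 0" "ell2_inner w v = 0"
    using ell2_inner_cnj[of v w] by (auto simp: ell2_inner_def)
  have "ell2_inner d d = 0"
    unfolding d_def using u vw by (simp add: ell2_inner_linear uu uv vu 0)
  then have "d = (\<lambda>n. 0)"
    using u vw ell2_norm_eq_0[of d] ell2_inner_self[of d] by (simp add: d_def)
  then have "u n = v n + w n" for n
    by (auto simp: d_def fun_eq_iff algebra_simps)
  then show ?thesis by (auto simp: v_def w_def)
qed

text \<open>Projecting a vector restricts its scalar measure. All statements about \<open>T\<close> on the range of \<open>P B\<close>
are read off from this density.\<close>

lemma scalar_measure_P: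
  assumes B: "B \<in> sets borel" and u: "u \<in> ell2"
  shows "scalar_spectral_measure P (P B u)
    = density (scalar_spectral_measure P u) (\<lambda>x. ennreal (indicator B x))"
proof (rule measure_eqI)
  fix D assume "D \<in> sets (scalar_spectral_measure P (P B u))"
  then have D: "D \<in> sets borel" by simp
  have "emeasure (density (scalar_spectral_measure P u) (\<lambda>x. ennreal (indicator B x))) D
      = emeasure (density (scalar_spectral_measure P u) (indicator B)) D"
    by (simp add: ennreal_indicator)
  also have "\<dots> = emeasure (scalar_spectral_measure P u) (B \<inter> D)"
    using B D by (intro emeasure_restricted) auto
  finally show "emeasure (scalar_spectral_measure P (P B u)) D
      = emeasure (density (scalar_spectral_measure P u) (\<lambda>x. ennreal (indicator B x))) D"
    using B u D by (simp add: emeasure_scalar_measure P_inter Int_commute)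
qed simp

lemma integrable_scalar_measure: "u \<in> ell2 \<Longrightarrow> integrable (scalar_spectral_measure P u) (\<lambda>x. x)"
  and T_form: "u \<in> ell2 \<Longrightarrow>
    ell2_inner u (T u) = complex_of_real (\<integral>x. x \<partial>scalar_spectral_measure P u)"
  using T_spectral by (auto simp: spectral_measure_of_def)

lemma T_form_P:
  assumes B: "B \<in> sets borel" and u: "u \<in> ell2"
  shows "ell2_inner (P B u) (T (P B u))
    = complex_of_real (\<integral>x. indicator B x * x \<partial>scalar_spectral_measure P u)"
  using T_form[OF P_ell2[OF B u]]
  unfolding scalar_measure_P[OF B u]
  using B by (subst (asm) integral_density) (auto simp: measurable_cong_sets[OF sets_scalar_measure refl])

lemma T_form_split:
  assumes B: "B \<in> sets borel" and u: "u \<in> ell2"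
  shows "ell2_inner u (T u)
    = ell2_inner (P B u) (T (P B u)) + ell2_inner (P (- B) u) (T (P (- B) u))"
proof -
  let ?M = "scalar_spectral_measure P u"
  have int: "integrable ?M (\<lambda>x. indicator A x * x)" if "A \<in> sets borel" for A :: "real set"
    using integrable_mult_indicator[OF _ integrable_scalar_measure[OF u], of A] that by simp
  have "(\<integral>x. x \<partial>?M) = (\<integral>x. indicator B x * x + indicator (- B) x * x \<partial>?M)"
    by (intro Bochner_Integration.integral_cong) (auto split: split_indicator)
  also have "\<dots> = (\<integral>x. indicator B x * x \<partial>?M) + (\<integral>x. indicator (- B) x * x \<partial>?M)"
    using B by (intro Bochner_Integration.integral_add int borel_compl)
  finally show ?thesis
    unfolding T_form[OF u] T_form_P[OF B u] T_form_P[OF borel_compl[OF B] u] by simp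
qed

text \<open>In effect \<open>T\<close> commutes with its spectral projections. Only the quadratic form of \<open>T\<close> is known, and it
splits along \<open>P B\<close> and \<open>P (- B)\<close>; hence the cross terms cancel for \<open>v + w\<close> and for \<open>v + iw\<close>, and
these two identities separate \<open>\<langle>v, Tw\<rangle>\<close> from \<open>\<langle>w, Tv\<rangle>\<close>.\<close>

lemma T_off_diagonal:
  assumes B: "B \<in> sets borel" and u: "u \<in> ell2"
  shows "ell2_inner (P B u) (T (P (- B) u)) = 0"
proof -
  define v w where "v = P B u" and "w = P (- B) u"
  have B': "- B \<in> sets borel" using B by (rule borel_compl)
  have vw: "v \<in> ell2" "w \<in> ell2" using B B' u by (auto simp: v_def w_def)
  have cross: "cnj a * ell2_inner w (T v) + a * ell2_inner v (T w) = 0" for a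
  proof -
    define x where "x = (\<lambda>n. v n + a * w n)"
    have x: "x \<in> ell2" using vw by (simp add: x_def)
    have Px: "P B x = v" "P (- B) x = (\<lambda>n. a * w n)"
      unfolding x_def bounded_op_add[OF P_bounded[OF B] vw(1) ell2_scale[OF vw(2)]]
        bounded_op_add[OF P_bounded[OF B'] vw(1) ell2_scale[OF vw(2)]]
        bounded_op_scale[OF P_bounded[OF B] vw(2)] bounded_op_scale[OF P_bounded[OF B'] vw(2)]
      using B B' u by (simp_all add: v_def w_def P_idem P_complement_P)
    have Tx: "T x = (\<lambda>n. T v n + a * T w n)"
      unfolding x_def bounded_op_add[OF T_bounded vw(1) ell2_scale[OF vw(2)]]
        bounded_op_scale[OF T_bounded vw(2)] ..
    show ?thesis
      using T_form_split[OF B x] vw T_bounded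
      unfolding Px Tx bounded_op_scale[OF T_bounded vw(2)] unfolding x_def
      by (simp add: ell2_inner_linear algebra_simps)
  qed
  have "ell2_inner w (T v) + ell2_inner v (T w) = 0" "ell2_inner v (T w) - ell2_inner w (T v) = 0"
    using cross[of 1] cross[of \<i>] by (auto simp: algebra_simps)
  then show ?thesis
    unfolding v_def w_def by (simp add: algebra_simps)
qed

lemma AE_scalar_measure_P:
  assumes B: "B \<in> sets borel" and u: "u \<in> ell2"
  shows "AE x in scalar_spectral_measure P (P B u). x \<in> B"
  unfolding scalar_measure_P[OF B u]
  using B by (subst AE_density) (auto simp: measurable_cong_sets[OF sets_scalar_measure refl] indicator_def)

lemma T_form_lower:
  assumes B: "B \<in> sets borel" and u: "u \<in> ell2" and "\<And>x. x \<in> B \<Longrightarrow> a \<le> x"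
  shows "a * (ell2_norm (P B u))\<^sup>2 \<le> Re (ell2_inner (P B u) (T (P B u)))"
proof -
  let ?M = "scalar_spectral_measure P (P B u)"
  interpret finite_measure ?M using B u by (intro finite_scalar_measure) simp
  have "a * (ell2_norm (P B u))\<^sup>2 = (\<integral>x. a \<partial>?M)"
    using B u by (simp add: measure_scalar_measure P_UNIV)
  also have "\<dots> \<le> (\<integral>x. x \<partial>?M)"
    using B u AE_scalar_measure_P[OF B u] assms(3)
    by (intro integral_mono_AE integrable_scalar_measure) auto
  finally show ?thesis using B u by (simp add: T_form)
qed

lemma T_form_upper:
  assumes B: "B \<in> sets borel" and u: "u \<in> ell2" and "\<And>x. x \<in> B \<Longrightarrow> x \<le> a"
  shows "Re (ell2_inner (P B u) (T (P B u))) \<le> a * (ell2_norm (P B u))\<^sup>2"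
proof -
  let ?M = "scalar_spectral_measure P (P B u)"
  interpret finite_measure ?M using B u by (intro finite_scalar_measure) simp
  have "(\<integral>x. x \<partial>?M) \<le> (\<integral>x. a \<partial>?M)"
    using B u AE_scalar_measure_P[OF B u] assms(3)
    by (intro integral_mono_AE integrable_scalar_measure) auto
  also have "\<dots> = a * (ell2_norm (P B u))\<^sup>2"
    using B u by (simp add: measure_scalar_measure P_UNIV)
  finally show ?thesis using B u by (simp add: T_form)
qed

lemma inner_P_residual:
  assumes B: "B \<in> sets borel" and u: "u \<in> ell2"
  shows "ell2_inner (P B u) (\<lambda>n. T u n - complex_of_real E * u n)
    = ell2_inner (P B u) (T (P B u)) - complex_of_real (E * (ell2_norm (P B u))\<^sup>2)"
proof -
  have B': "- B \<in> sets borel" using B by (rule borel_compl)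
  have "T u = T (\<lambda>n. P B u n + P (- B) u n)"
    using P_decompose[OF B u] by simp
  also have "\<dots> = (\<lambda>n. T (P B u) n + T (P (- B) u) n)"
    using B B' u T_bounded by (simp add: bounded_op_add)
  finally have "ell2_inner (P B u) (T u) = ell2_inner (P B u) (T (P B u))"
    using B B' u T_bounded T_off_diagonal[OF B u] by (simp add: ell2_inner_add_right)
  moreover have "ell2_inner (P B u) u = complex_of_real ((ell2_norm (P B u))\<^sup>2)"
    using P_symmetric[OF B u u] inner_P[OF B u] by simp
  ultimately show ?thesis
    using B u T_bounded by (simp add: ell2_inner_diff_right ell2_inner_scale_right)
qed

lemma residual_bound:
  assumes B: "B \<in> sets borel" and u: "u \<in> ell2"
    and le: "d * (ell2_norm (P B u))\<^sup>2
      \<le> \<bar>Re (ell2_inner (P B u) (\<lambda>n. T u n - complex_of_real E * u n))\<bar>"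
  shows "d * ell2_norm (P B u) \<le> ell2_norm (\<lambda>n. T u n - complex_of_real E * u n)"
proof (cases "ell2_norm (P B u) = 0")
  case False
  let ?r = "\<lambda>n. T u n - complex_of_real E * u n"
  have "?r \<in> ell2" using u T_bounded by simp
  then have "\<bar>Re (ell2_inner (P B u) ?r)\<bar> \<le> ell2_norm (P B u) * ell2_norm ?r"
    using abs_Re_le_cmod[of "ell2_inner (P B u) ?r"] ell2_Cauchy_Schwarz[OF P_ell2[OF B u]]
    by fastforce
  with le have "ell2_norm (P B u) * (d * ell2_norm (P B u)) \<le> ell2_norm (P B u) * ell2_norm ?r"
    by (simp add: power2_eq_square algebra_simps)
  then show ?thesis
    using False ell2_norm_nonneg[of "P B u"] by simp
qed simp

text \<open>This is Chebyshev's inequality for the spectral measure: the parts of \<open>u\<close> with spectrum above \<open>E + d\<close>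
and below \<open>E - d\<close> have norm at most \<open>1/d\<close> times the residual, because the quadratic form of \<open>T - E\<close>
is bounded away from zero, with a fixed sign, on each of them.\<close>

lemma spectral_projection_residual:
  assumes I: "open I" "E \<in> I"
  obtains K where "K > 0"
    "\<And>u. u \<in> ell2 \<Longrightarrow> ell2_norm (\<lambda>n. u n - P I u n)
      \<le> K * ell2_norm (\<lambda>n. T u n - complex_of_real E * u n)"
proof -
  obtain d where d: "d > 0" "ball E d \<subseteq> I"
    using I open_contains_ball by blast
  have Ib: "I \<in> sets borel" using I by simp
  show thesis
  proof
    show "2 / d > 0" using d by simp
    fix u :: "'a \<Rightarrow> complex" assume u: "u \<in> ell2"
    let ?r = "ell2_norm (\<lambda>n. T u n - complex_of_real E * u n)"
    define r where "r = ?r"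
    have "d * ell2_norm (P {E + d..} u) \<le> ?r"
    proof (rule residual_bound)
      show "d * (ell2_norm (P {E + d..} u))\<^sup>2
          \<le> \<bar>Re (ell2_inner (P {E + d..} u) (\<lambda>n. T u n - complex_of_real E * u n))\<bar>"
        using T_form_lower[of "{E + d..}" u "E + d"] u
        by (simp add: inner_P_residual algebra_simps)
    qed (use u in auto)
    then have hi: "ell2_norm (P {E + d..} u) \<le> r / d"
      using d by (simp add: field_simps r_def)
    have "d * ell2_norm (P {..E - d} u) \<le> ?r"
    proof (rule residual_bound)
      show "d * (ell2_norm (P {..E - d} u))\<^sup>2
          \<le> \<bar>Re (ell2_inner (P {..E - d} u) (\<lambda>n. T u n - complex_of_real E * u n))\<bar>"
        using T_form_upper[of "{..E - d}" u "E - d"] u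
        by (simp add: inner_P_residual algebra_simps)
    qed (use u in auto)
    then have lo: "ell2_norm (P {..E - d} u) \<le> r / d"
      using d by (simp add: field_simps r_def)
    have "- I \<subseteq> {E + d..} \<union> {..E - d}"
    proof
      fix x assume "x \<in> - I"
      then have "\<not> \<bar>E - x\<bar> < d" using d(2) by (auto simp: ball_def dist_real_def)
      then show "x \<in> {E + d..} \<union> {..E - d}" by auto
    qed
    then have "(ell2_norm (P (- I) u))\<^sup>2
        \<le> (ell2_norm (P {E + d..} u))\<^sup>2 + (ell2_norm (P {..E - d} u))\<^sup>2"
      using u Ib by (intro P_norm_subadditive borel_compl) auto
    also have "\<dots> \<le> (r / d)\<^sup>2 + (r / d)\<^sup>2"
      by (intro add_mono power_mono hi lo) auto
    also have "\<dots> \<le> (2 / d * r)\<^sup>2"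
      by (simp add: power_mult_distrib power_divide divide_right_mono)
    finally have "(ell2_norm (P (- I) u))\<^sup>2 \<le> (2 / d * r)\<^sup>2" .
    moreover have "0 \<le> 2 / d * r" using d by (simp add: r_def)
    ultimately have "ell2_norm (P (- I) u) \<le> 2 / d * r"
      by (rule power2_le_imp_le)
    moreover have "(\<lambda>n. u n - P I u n) = P (- I) u"
      using fun_cong[OF P_decompose[OF Ib u]] by (auto simp: algebra_simps)
    ultimately show "ell2_norm (\<lambda>n. u n - P I u n) \<le> 2 / d * ?r"
      by (simp add: r_def)
  qed
qed

end


section \<open>Truncated plane waves\<close>

lemma shift_bij: "bij (\<lambda>n :: int ^ 2. n - axis i k)"
  by (rule bij_betw_byWitness[where f' = "\<lambda>n. n + axis i k"]) auto

lemma shift_ell2 [simp]: "u \<in> ell2 \<Longrightarrow> shift i k u \<in> ell2"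
  using summable_on_reindex_bij_betw[OF shift_bij[of i k], of "\<lambda>n. (cmod (u n))\<^sup>2"]
  by (simp add: ell2_def shift_def)

lemma shift_norm: "ell2_norm (shift i k u) = ell2_norm u"
  using infsum_reindex_bij_betw[OF shift_bij[of i k], of "\<lambda>n. (cmod (u n))\<^sup>2"]
  by (simp add: ell2_norm_def shift_def)

lemma Laplacian_bounded: "bounded_op Laplacian"
proof -
  have ell2: "Laplacian u \<in> ell2" if "u \<in> ell2" for u
    unfolding Laplacian_def using that by (intro ell2_sum ell2_scale ell2_add shift_ell2) auto
  have "ell2_norm (Laplacian u) \<le> 2 * ell2_norm u" if u: "u \<in> ell2" for u
  proof -
    have "ell2_norm (Laplacian u)
        \<le> (\<Sum>i\<in>UNIV. ell2_norm (\<lambda>n. 1 / 2 * (shift i 1 u n + shift i (- 1) u n)))"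
      unfolding Laplacian_def using u
      by (intro ell2_norm_sum ell2_scale ell2_add shift_ell2) auto
    also have "\<dots> = (\<Sum>i\<in>UNIV. 1 / 2 * ell2_norm (\<lambda>n. shift i 1 u n + shift i (- 1) u n))"
      by (subst ell2_norm_scale) simp
    also have "\<dots> \<le> (\<Sum>i\<in>(UNIV :: 2 set). 1 / 2 * (ell2_norm u + ell2_norm u))"
    proof (intro sum_mono mult_left_mono)
      show "ell2_norm (\<lambda>n. shift i 1 u n + shift i (- 1) u n) \<le> ell2_norm u + ell2_norm u" for i
        using ell2_norm_triangle[OF shift_ell2[OF u, of i 1] shift_ell2[OF u, of i "-1"]]
        by (simp add: shift_norm)
    qed auto
    also have "\<dots> = 2 * ell2_norm u" by simp
    finally show ?thesis .
  qed
  moreover have "Laplacian (\<lambda>n. a * u n + b * v n) = (\<lambda>n. a * Laplacian u n + b * Laplacian v n)"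
    for a b u v
    by (rule ext) (simp add: Laplacian_def shift_def sum_2 algebra_simps)
  ultimately show ?thesis
    unfolding bounded_op_def using ell2 by blast
qed

lemma card_vec_box:
  fixes A :: "'n::finite \<Rightarrow> 'a set"
  shows "card {x :: 'a ^ 'n. \<forall>i. x $ i \<in> A i} = (\<Prod>i\<in>UNIV. card (A i))"
proof -
  have "bij_betw vec_lambda (PiE UNIV A) {x. \<forall>i. x $ i \<in> A i}"
    by (rule bij_betw_byWitness[where f' = vec_nth]) auto
  then have "card (PiE UNIV A) = card {x. \<forall>i. x $ i \<in> A i}"
    by (rule bij_betw_same_card)
  then show ?thesis by (simp add: card_PiE)
qed

lemma finite_vec_box:
  fixes A :: "'n::finite \<Rightarrow> 'a set"
  assumes "\<And>i. finite (A i)"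
  shows "finite {x :: 'a ^ 'n. \<forall>i. x $ i \<in> A i}"
proof -
  have "{x :: 'a ^ 'n. \<forall>i. x $ i \<in> A i} \<subseteq> vec_lambda ` PiE UNIV A"
  proof
    fix x :: "'a ^ 'n" assume "x \<in> {x. \<forall>i. x $ i \<in> A i}"
    then have "vec_nth x \<in> PiE UNIV A" by auto
    then have "vec_lambda (vec_nth x) \<in> vec_lambda ` PiE UNIV A" by (rule imageI)
    then show "x \<in> vec_lambda ` PiE UNIV A" by simp
  qed
  then show ?thesis
    by (rule finite_subset) (intro finite_imageI finite_PiE, use assms in auto)
qed

lemma ell2_norm_square_le_card:
  assumes fin: "finite D" and le: "\<And>n. cmod (u n) \<le> a" and zero: "\<And>n. n \<notin> D \<Longrightarrow> u n = 0"
    and "0 \<le> a"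
  shows "(ell2_norm u)\<^sup>2 \<le> a\<^sup>2 * real (card D)"
proof -
  have "(ell2_norm u)\<^sup>2 = (\<Sum>\<^sub>\<infinity>n\<in>D. (cmod (u n))\<^sup>2)"
    unfolding ell2_norm_square using zero by (intro infsum_cong_neutral) auto
  also have "\<dots> = (\<Sum>n\<in>D. (cmod (u n))\<^sup>2)" using fin by simp
  also have "\<dots> \<le> (\<Sum>n\<in>D. a\<^sup>2)" by (intro sum_mono power_mono le) auto
  finally show ?thesis by (simp add: mult.commute)
qed

definition lattice_box :: "nat \<Rightarrow> (int ^ 2) set" where
  "lattice_box L = {n. \<forall>i. n $ i \<in> {0..<int L}}"

definition wave :: "real ^ 2 \<Rightarrow> nat \<Rightarrow> lattice_fun" where
  "wave \<theta> L n = (if n \<in> lattice_box L then cis (\<Sum>i\<in>UNIV. \<theta> $ i * of_int (n $ i)) / of_nat L else 0)"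

lemma finite_lattice_box: "finite (lattice_box L)"
  unfolding lattice_box_def by (rule finite_vec_box) simp

lemma card_lattice_box: "card (lattice_box L) = L ^ 2"
  unfolding lattice_box_def by (subst card_vec_box) (simp add: power2_eq_square)

lemma wave_compact_supp: "wave \<theta> L \<in> compact_supp"
  unfolding compact_supp_def
  by (auto simp: wave_def intro: finite_subset[OF _ finite_lattice_box[of L]])

lemma norm_wave:
  assumes "L > 0"
  shows "ell2_norm (wave \<theta> L) = 1"
proof -
  have "(ell2_norm (wave \<theta> L))\<^sup>2 = (\<Sum>\<^sub>\<infinity>n\<in>lattice_box L. (1 / real L)\<^sup>2)"
    unfolding ell2_norm_square by (rule infsum_cong_neutral) (auto simp: wave_def norm_divide)
  also have "\<dots> = 1"
    using assms by (simp add: finite_lattice_box card_lattice_box power_divide)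
  finally show ?thesis by (simp add: power2_eq_1_iff) (use ell2_norm_nonneg[of "wave \<theta> L"] in linarith)
qed

text \<open>A shift by \<open>k\<close> multiplies a plane wave by a phase; the truncation matters only within distance \<open>\<bar>k\<bar>\<close> of
two opposite sides of the box, at no more than \<open>4 \<bar>k\<bar> L\<close> points.\<close>

lemma wave_shift:
  assumes "L > 0"
  shows "(ell2_norm (\<lambda>n. shift i k (wave \<theta> L) n - cis (- (of_int k * \<theta> $ i)) * wave \<theta> L n))\<^sup>2
    \<le> 4 * \<bar>of_int k\<bar> / real L"
proof -
  define J where "J = {-\<bar>k\<bar>..<\<bar>k\<bar>} \<union> {int L - \<bar>k\<bar>..<int L + \<bar>k\<bar>}"
  define D where "D = {n :: int ^ 2. \<forall>l. n $ l \<in> (if l = i then J else {0..<int L})}"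
  let ?d = "\<lambda>n. shift i k (wave \<theta> L) n - cis (- (of_int k * \<theta> $ i)) * wave \<theta> L n"
  have fin: "finite D"
    unfolding D_def by (rule finite_vec_box) (simp add: J_def)
  have "card D = card J * L"
    unfolding D_def using exhaust_2[of i] by (subst card_vec_box) (auto simp: UNIV_2)
  moreover have "card J \<le> nat (2 * \<bar>k\<bar>) + nat (2 * \<bar>k\<bar>)"
    unfolding J_def by (rule order_trans[OF card_Un_le]) simp
  ultimately have card: "real (card D) \<le> 4 * \<bar>of_int k\<bar> * real L"
    by (simp add: mult_right_mono)
  have phase: "(\<Sum>l\<in>UNIV. \<theta> $ l * of_int ((n - axis i k) $ l))
      = - (of_int k * \<theta> $ i) + (\<Sum>l\<in>UNIV. \<theta> $ l * of_int (n $ l))" for n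
    using exhaust_2[of i] by (auto simp: sum_2 axis_def algebra_simps)
  have both: "?d n = 0" if "n - axis i k \<in> lattice_box L" "n \<in> lattice_box L" for n
    unfolding shift_def wave_def phase using that by (simp add: cis_mult)
  have mem_D: "n \<in> D" if "(n - axis i k \<in> lattice_box L) \<noteq> (n \<in> lattice_box L)" for n
  proof -
    have "n $ l \<in> {0..<int L}" if "l \<noteq> i" for l
      using \<open>(n - axis i k \<in> lattice_box L) \<noteq> (n \<in> lattice_box L)\<close> that
      unfolding lattice_box_def by (auto simp: axis_def dest!: spec[where x = l])
    moreover have "n $ i \<in> J"
    proof (rule ccontr)
      assume "n $ i \<notin> J"
      then have "n $ i \<in> {0..<int L} \<longleftrightarrow> (n - axis i k) $ i \<in> {0..<int L}"
        by (auto simp: J_def axis_def)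
      moreover have "n $ l \<in> {0..<int L} \<longleftrightarrow> (n - axis i k) $ l \<in> {0..<int L}" if "l \<noteq> i" for l
        using that by (simp add: axis_def)
      ultimately have "\<forall>l. n $ l \<in> {0..<int L} \<longleftrightarrow> (n - axis i k) $ l \<in> {0..<int L}"
        by metis
      with that show False unfolding lattice_box_def by blast
    qed
    ultimately show ?thesis by (simp add: D_def)
  qed
  have "(ell2_norm ?d)\<^sup>2 \<le> (1 / real L)\<^sup>2 * real (card D)"
  proof (rule ell2_norm_square_le_card[OF fin])
    show "?d n = 0" if "n \<notin> D" for n
      using mem_D[of n] both[of n] that by (auto simp: shift_def wave_def)
    show "cmod (?d n) \<le> 1 / real L" for n
      using both[of n] by (cases "n - axis i k \<in> lattice_box L"; cases "n \<in> lattice_box L")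
        (auto simp: shift_def wave_def norm_divide norm_mult)
  qed simp
  also have "\<dots> \<le> (1 / real L)\<^sup>2 * (4 * \<bar>of_int k\<bar> * real L)"
    by (intro mult_left_mono card) simp
  also have "\<dots> = 4 * \<bar>of_int k\<bar> / real L"
    using assms by (simp add: power2_eq_square)
  finally show ?thesis .
qed

text \<open>Of truncated plane waves only the following is used: normalisation, finite support, and
asymptotic diagonalisation of every shift with the Fourier phases of \<open>\<theta>\<close>.\<close>

definition approx_plane_wave :: "real ^ 2 \<Rightarrow> (nat \<Rightarrow> lattice_fun) \<Rightarrow> bool" where
  "approx_plane_wave \<theta> u \<longleftrightarrow>
     (\<forall>L. u L \<in> compact_supp \<and> ell2_norm (u L) = 1) \<and>
     (\<forall>i k. (\<lambda>L. ell2_norm (\<lambda>n. shift i k (u L) n - cis (- (of_int k * \<theta> $ i)) * u L n)) \<longlonglongrightarrow> 0)"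

lemma approx_plane_wave_exists:
  "\<exists>u. approx_plane_wave \<theta> u"
proof
  have "(\<lambda>L. ell2_norm (\<lambda>n. shift i k (wave \<theta> (Suc L)) n - cis (- (of_int k * \<theta> $ i)) * wave \<theta> (Suc L) n)) \<longlonglongrightarrow> 0"
    (is "?f \<longlonglongrightarrow> 0") for i k
  proof -
    have "(\<lambda>L. (?f L)\<^sup>2) \<longlonglongrightarrow> 0"
    proof (rule tendsto_sandwich[OF always_eventually always_eventually tendsto_const])
      show "(\<lambda>L. 4 * \<bar>of_int k\<bar> / real (Suc L)) \<longlonglongrightarrow> 0"
        using LIMSEQ_Suc[OF lim_const_over_n[of "4 * \<bar>of_int k\<bar> :: real"]] by simp
      show "\<forall>L. (?f L)\<^sup>2 \<le> 4 * \<bar>of_int k\<bar> / real (Suc L)"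
        by (intro allI wave_shift) simp
    qed simp
    then have "(\<lambda>L. sqrt ((?f L)\<^sup>2)) \<longlonglongrightarrow> sqrt 0"
      by (rule tendsto_real_sqrt)
    then show ?thesis by simp
  qed
  then show "approx_plane_wave \<theta> (\<lambda>L. wave \<theta> (Suc L))"
    by (simp add: approx_plane_wave_def wave_compact_supp norm_wave)
qed

lemma approx_plane_waveD:
  assumes "approx_plane_wave \<theta> u"
  shows "u L \<in> compact_supp" "u L \<in> ell2" "ell2_norm (u L) = 1"
    "(\<lambda>L. ell2_norm (\<lambda>n. shift i k (u L) n - cis (- (of_int k * \<theta> $ i)) * u L n)) \<longlonglongrightarrow> 0"
  using assms compact_supp_subset_ell2 unfolding approx_plane_wave_def by auto

lemma approx_plane_wave_inner_shift:
  assumes "approx_plane_wave \<theta> u"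
  shows "(\<lambda>L. ell2_inner (u L) (shift i k (u L))) \<longlonglongrightarrow> cis (- (of_int k * \<theta> $ i))"
proof -
  note u = approx_plane_waveD[OF assms]
  let ?e = "cis (- (of_int k * \<theta> $ i))"
  have "cmod (ell2_inner (u L) (shift i k (u L)) - ?e)
      \<le> ell2_norm (\<lambda>n. shift i k (u L) n - ?e * u L n)" for L
  proof -
    have "ell2_inner (u L) (shift i k (u L)) - ?e
        = ell2_inner (u L) (\<lambda>n. shift i k (u L) n - ?e * u L n)"
      using u(2,3) by (simp add: ell2_inner_linear ell2_inner_self)
    also have "cmod \<dots> \<le> ell2_norm (u L) * ell2_norm (\<lambda>n. shift i k (u L) n - ?e * u L n)"
      using u(2) by (intro ell2_Cauchy_Schwarz) auto
    finally show ?thesis using u(3) by simp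
  qed
  then have "(\<lambda>L. ell2_inner (u L) (shift i k (u L)) - ?e) \<longlonglongrightarrow> 0"
    by (intro Lim_null_comparison[OF always_eventually u(4)]) blast
  then show ?thesis by (simp add: LIM_zero_iff)
qed

lemma approx_plane_wave_Laplacian:
  fixes \<theta> :: "real ^ 2"
  assumes "approx_plane_wave \<theta> u" and E: "E = (\<Sum>i\<in>UNIV. cos (\<theta> $ i))"
  shows "(\<lambda>L. ell2_norm (\<lambda>n. Laplacian (u L) n - complex_of_real E * u L n)) \<longlonglongrightarrow> 0"
proof -
  note u = approx_plane_waveD[OF assms(1)]
  define d where "d i k L n = shift i k (u L) n - cis (- (of_int k * \<theta> $ i)) * u L n" for i k L n
  have d: "d i k L \<in> ell2" for i k L
    unfolding d_def using u(2) by simp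
  have eq: "(\<lambda>n. Laplacian (u L) n - complex_of_real E * u L n)
      = (\<lambda>n. \<Sum>i\<in>UNIV. 1 / 2 * (d i 1 L n + d i (- 1) L n))" for L
  proof
    fix n
    have "cis (- x) + cis x = 2 * complex_of_real (cos x)" for x
      by (simp add: complex_eq_iff)
    then have "(\<Sum>i\<in>UNIV. 1 / 2 * (cis (- (\<theta> $ i)) + cis (\<theta> $ i)) * u L n) = complex_of_real E * u L n"
      by (simp add: E sum_distrib_right)
    then show "Laplacian (u L) n - complex_of_real E * u L n
      = (\<Sum>i\<in>UNIV. 1 / 2 * (d i 1 L n + d i (- 1) L n))"
      by (simp add: Laplacian_def d_def sum_2 algebra_simps)
  qed
  have "ell2_norm (\<lambda>n. Laplacian (u L) n - complex_of_real E * u L n)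
      \<le> (\<Sum>i\<in>UNIV. ell2_norm (d i 1 L) + ell2_norm (d i (- 1) L))" for L
  proof -
    have "ell2_norm (\<lambda>n. Laplacian (u L) n - complex_of_real E * u L n)
      \<le> (\<Sum>i\<in>UNIV. ell2_norm (\<lambda>n. 1 / 2 * (d i 1 L n + d i (- 1) L n)))"
      unfolding eq by (intro ell2_norm_sum ell2_scale ell2_add d) simp
    also have "\<dots> \<le> (\<Sum>i\<in>UNIV. ell2_norm (d i 1 L) + ell2_norm (d i (- 1) L))"
    proof (rule sum_mono)
      fix i :: 2
      show "ell2_norm (\<lambda>n. 1 / 2 * (d i 1 L n + d i (- 1) L n))
          \<le> ell2_norm (d i 1 L) + ell2_norm (d i (- 1) L)"
        using ell2_norm_triangle[OF d d, of i 1 L i "-1" L]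
        unfolding ell2_norm_scale
        by simp (use ell2_norm_nonneg[of "d i 1 L"] ell2_norm_nonneg[of "d i (- 1) L"] in linarith)
    qed
    finally show ?thesis .
  qed
  then have "\<forall>L. norm (ell2_norm (\<lambda>n. Laplacian (u L) n - complex_of_real E * u L n))
      \<le> (\<Sum>i\<in>UNIV. ell2_norm (d i 1 L) + ell2_norm (d i (- 1) L))"
    by simp
  moreover have "(\<lambda>L. \<Sum>i\<in>UNIV. ell2_norm (d i 1 L) + ell2_norm (d i (- 1) L))
      \<longlonglongrightarrow> (\<Sum>i\<in>(UNIV :: 2 set). 0 + 0)"
    unfolding d_def by (intro tendsto_sum tendsto_add u(4))
  then have "(\<lambda>L. \<Sum>i\<in>UNIV. ell2_norm (d i 1 L) + ell2_norm (d i (- 1) L)) \<longlonglongrightarrow> 0"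
    by (simp only: add_0 sum.neutral_const)
  ultimately show ?thesis
    by (rule Lim_null_comparison[OF always_eventually])
qed

text \<open>Weyl's criterion: approximate eigenvectors exclude a bounded inverse of \<open>\<Delta> - E\<close>.\<close>

lemma sum_cos_in_spectrum:
  fixes \<theta> :: "real ^ 2"
  assumes E: "E = (\<Sum>i\<in>UNIV. cos (\<theta> $ i))"
  shows "E \<in> sigma_Laplacian"
proof (rule ccontr)
  assume "E \<notin> sigma_Laplacian"
  then obtain R where R: "bounded_op R"
    "\<And>u. u \<in> ell2 \<Longrightarrow> R (\<lambda>n. Laplacian u n - complex_of_real E * u n) = u"
    unfolding sigma_Laplacian_def op_spectrum_def by blast
  obtain K where K: "K > 0" "\<And>u. u \<in> ell2 \<Longrightarrow> ell2_norm (R u) \<le> K * ell2_norm u"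
    using bounded_op_bound[OF R(1)] by blast
  obtain u where "approx_plane_wave \<theta> u" using approx_plane_wave_exists by blast
  note u = approx_plane_waveD[OF this] approx_plane_wave_Laplacian[OF this E]
  have "1 \<le> K * ell2_norm (\<lambda>n. Laplacian (u L) n - complex_of_real E * u L n)" for L
    using K(2)[of "\<lambda>n. Laplacian (u L) n - complex_of_real E * u L n"] R(2)[OF u(2)[of L]]
      u(2,3)[of L] Laplacian_bounded by simp
  moreover have "(\<lambda>L. K * ell2_norm (\<lambda>n. Laplacian (u L) n - complex_of_real E * u L n)) \<longlonglongrightarrow> K * 0"
    by (intro tendsto_intros u(5))
  ultimately have "1 \<le> K * 0" by (intro LIMSEQ_le_const) auto
  then show False by simp
qed


section \<open>The commutator with a conjugate operator\<close>

definition conj_core_sum :: "nat \<Rightarrow> nat \<Rightarrow> lattice_fun \<Rightarrow> lattice_fun" where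
  "conj_core_sum j \<kappa> u n = (\<Sum>i\<in>UNIV. conj_core i j \<kappa> u n)"

text \<open>The commutator \<open>[\<Delta>, iA]\<close> for the single operator \<open>A\<close> with \<open>m = j\<kappa>\<close>. On a plane wave it acts as
\<open>\<Sum>\<^sub>i (cos ((m - 1)\<theta>\<^sub>i) - cos ((m + 1)\<theta>\<^sub>i)) / 2 = \<Sum>\<^sub>i sin \<theta>\<^sub>i sin (m\<theta>\<^sub>i)\<close>.\<close>

definition commutator_term :: "nat \<Rightarrow> lattice_fun \<Rightarrow> lattice_fun" where
  "commutator_term m u n = (\<Sum>i\<in>UNIV. 1 / 4 *
     (shift i (int m - 1) u n + shift i (1 - int m) u n
      - shift i (int m + 1) u n - shift i (- int m - 1) u n))"

lemma axis_add_eq: "axis i a + axis i b = (axis i (a + b) :: int ^ 2)"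
  by (auto simp: axis_def vec_eq_iff)

lemma conj_core_explicit:
  "conj_core i j \<kappa> u n = 1 / (4 * \<i>) *
    (of_int (2 * n $ i - int (j * \<kappa>)) * u (n + axis i (- int (j * \<kappa>)))
     - of_int (2 * n $ i + int (j * \<kappa>)) * u (n + axis i (int (j * \<kappa>))))"
proof -
  have minus: "n - axis i a = n + axis i (- a)" for a :: int
    by (auto simp: axis_def vec_eq_iff)
  have comp: "axis i a $ i = a" for a :: int
    by (simp add: axis_def)
  show ?thesis
    unfolding conj_core_def shift_diff_def shift_def position_def minus vector_add_component comp
    by (simp add: algebra_simps)
qed

text \<open>The terms that grow with the position cancel. Contributions in which the Laplacian and the conjugate
operator act along different axes cancel entirely.\<close>

lemma conj_core_commutator:
  "\<i> * Laplacian (conj_core_sum j \<kappa> u) n - \<i> * conj_core_sum j \<kappa> (Laplacian u) n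
    = commutator_term (j * \<kappa>) u n"
proof -
  define m where "m = int (j * \<kappa>)"
  \<comment> \<open>Naming the translates of \<open>u\<close> by their offsets makes the identity a linear one.\<close>
  define S where "S p a = u (n + axis p a)" for p a
  define X where "X a b = u (n + axis 1 a + axis 2 b)" for a b
  have minus: "k - axis i a = k + axis i (- a)" for a :: int and i :: 2 and k
    by (auto simp: axis_def vec_eq_iff)
  have X1: "u (n + axis 1 a + axis 1 b) = S 1 (a + b)" for a b
    by (simp add: S_def add.assoc axis_add_eq)
  have X2: "u (n + axis 2 a + axis 2 b) = S 2 (a + b)" for a b
    by (simp add: S_def add.assoc axis_add_eq)
  have X12: "u (n + axis 1 a + axis 2 b) = X a b" for a b
    by (simp add: X_def)
  have X21: "u (n + axis 2 a + axis 1 b) = X b a" for a b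
    by (simp add: X_def add_ac)
  have S: "u (n + axis p a) = S p a" for p a by (simp add: S_def)
  have comp: "(n + axis i a) $ i = n $ i + a" "(n + axis 1 a) $ 2 = n $ 2" "(n + axis 2 a) $ 1 = n $ 1"
    for a i by (auto simp: axis_def)
  have quarter: "1 / (4 * \<i>) = - (\<i> / 4)" by (simp add: complex_eq_iff)
  show ?thesis
    unfolding commutator_term_def conj_core_sum_def Laplacian_def shift_def sum_2
      conj_core_explicit m_def[symmetric] minus X1 X2 X12 X21 S comp quarter
    by (simp add: algebra_simps)
qed


lemma finite_support_translate:
  fixes a :: "int ^ 2"
  assumes "u \<in> compact_supp"
  shows "finite {n. u (n + a) \<noteq> 0}"
proof -
  have "finite ((\<lambda>n. n + a) -` {n. u n \<noteq> 0})"
    using assms by (intro finite_vimageI) (auto simp: compact_supp_def inj_def)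
  then show ?thesis by (simp add: vimage_def)
qed

lemma conj_core_compact_supp:
  assumes "u \<in> compact_supp"
  shows "conj_core i j \<kappa> u \<in> compact_supp"
proof -
  have "{n. conj_core i j \<kappa> u n \<noteq> 0} \<subseteq>
      {n. u (n + axis i (- int (j * \<kappa>))) \<noteq> 0} \<union> {n. u (n + axis i (int (j * \<kappa>))) \<noteq> 0}"
    by (auto simp: conj_core_explicit)
  then show ?thesis
    unfolding compact_supp_def mem_Collect_eq
    by (rule finite_subset) (use finite_support_translate[OF assms] in blast)
qed

lemma Laplacian_compact_supp:
  assumes "u \<in> compact_supp"
  shows "Laplacian u \<in> compact_supp"
proof -
  have "{n. Laplacian u n \<noteq> 0} \<subseteq>
      (\<Union>i\<in>UNIV. {n. u (n + - axis i 1) \<noteq> 0} \<union> {n. u (n + - axis i (- 1)) \<noteq> 0})"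
    unfolding Laplacian_def shift_def by (auto intro!: sum.neutral)
  then show ?thesis
    unfolding compact_supp_def mem_Collect_eq
    by (rule finite_subset) (intro finite_UN_I finite_UnI finite_support_translate assms finite)
qed

text \<open>Convergence in norm implies pointwise convergence. Therefore taking closures of the operators
enlarges their domains without changing the local formula by which they act, and the domains need
not be determined.\<close>

lemma op_closure_pointwise:
  assumes G: "\<And>x y. (x, y) \<in> G \<Longrightarrow> x \<in> ell2 \<and> y \<in> ell2 \<and> y = F x"
    and cont: "\<And>f u n. (\<And>n. (\<lambda>k. f k n) \<longlonglongrightarrow> u n) \<Longrightarrow> (\<lambda>k. F (f k) n) \<longlonglongrightarrow> F u n"
    and uv: "(u, v) \<in> op_closure G"
  shows "u \<in> ell2 \<and> v \<in> ell2 \<and> v = F u"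
proof -
  obtain f g where fg: "\<And>k. (f k, g k) \<in> G" "ell2_tendsto f u" "ell2_tendsto g v"
    and ell2: "u \<in> ell2" "v \<in> ell2"
    using uv unfolding op_closure_def by auto
  have fe: "f k \<in> ell2" and ge: "g k \<in> ell2" and gF: "g k = F (f k)" for k
    using G[OF fg(1)] by blast+
  have "v n = F u n" for n
  proof (rule LIMSEQ_unique)
    show "(\<lambda>k. g k n) \<longlonglongrightarrow> v n"
      by (rule ell2_tendsto_pointwise[OF fg(3) ge ell2(2)])
    show "(\<lambda>k. g k n) \<longlonglongrightarrow> F u n"
      unfolding gF by (rule cont) (rule ell2_tendsto_pointwise[OF fg(2) fe ell2(1)])
  qed
  then show ?thesis using ell2 by blast
qed

lemma conj_core_tendsto:
  assumes "\<And>n. (\<lambda>k. f k n) \<longlonglongrightarrow> u n"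
  shows "(\<lambda>k. conj_core i j \<kappa> (f k) n) \<longlonglongrightarrow> conj_core i j \<kappa> u n"
  unfolding conj_core_explicit by (intro tendsto_intros assms)

lemma conj_dir_pointwise:
  assumes "(u, v) \<in> conj_dir i j \<kappa>"
  shows "u \<in> ell2 \<and> v \<in> ell2 \<and> v = conj_core i j \<kappa> u"
proof (rule op_closure_pointwise[where F = "conj_core i j \<kappa>"])
  show "(u, v) \<in> op_closure {(u, conj_core i j \<kappa> u) |u. u \<in> compact_supp}"
    using assms by (simp add: conj_dir_def)
next
  fix x y assume "(x, y) \<in> {(u, conj_core i j \<kappa> u) |u. u \<in> compact_supp}"
  then show "x \<in> ell2 \<and> y \<in> ell2 \<and> y = conj_core i j \<kappa> x"
    using conj_core_compact_supp compact_supp_subset_ell2 by blast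
next
  fix f :: "nat \<Rightarrow> lattice_fun" and u n assume "\<And>n. (\<lambda>k. f k n) \<longlonglongrightarrow> u n"
  then show "(\<lambda>k. conj_core i j \<kappa> (f k) n) \<longlonglongrightarrow> conj_core i j \<kappa> u n"
    by (rule conj_core_tendsto)
qed

lemma conj_sum_pointwise:
  assumes "(u, v) \<in> conj_sum j \<kappa>"
  shows "u \<in> ell2 \<and> v \<in> ell2 \<and> v = conj_core_sum j \<kappa> u"
proof (rule op_closure_pointwise[where F = "conj_core_sum j \<kappa>"])
  show "(u, v) \<in> op_closure {(u, \<lambda>n. \<Sum>i\<in>UNIV. w i n) | u w. \<forall>i. (u, w i) \<in> conj_dir i j \<kappa>}"
    using assms by (simp add: conj_sum_def)
next
  fix x y assume "(x, y) \<in> {(u, \<lambda>n. \<Sum>i\<in>UNIV. w i n) | u w. \<forall>i. (u, w i) \<in> conj_dir i j \<kappa>}"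
  then obtain w where y: "y = (\<lambda>n. \<Sum>i\<in>UNIV. w i n)" and w: "\<And>i. (x, w i) \<in> conj_dir i j \<kappa>"
    by auto
  have "x \<in> ell2" and ell2: "w i \<in> ell2" and wi: "w i = conj_core i j \<kappa> x" for i
    using conj_dir_pointwise[OF w] by blast+
  then show "x \<in> ell2 \<and> y \<in> ell2 \<and> y = conj_core_sum j \<kappa> x"
    unfolding y conj_core_sum_def[abs_def] wi[symmetric] using ell2 by (intro conjI ell2_sum) auto
next
  fix f :: "nat \<Rightarrow> lattice_fun" and u n assume "\<And>n. (\<lambda>k. f k n) \<longlonglongrightarrow> u n"
  then show "(\<lambda>k. conj_core_sum j \<kappa> (f k) n) \<longlonglongrightarrow> conj_core_sum j \<kappa> u n"
    unfolding conj_core_sum_def by (intro tendsto_sum) (rule conj_core_tendsto)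
qed

lemma lin_comb_pointwise:
  assumes "(u, v) \<in> lin_comb \<rho> \<kappa>"
  shows "(\<lambda>M. \<Sum>j=1..M. complex_of_real (\<rho> (j * \<kappa>)) * conj_core_sum j \<kappa> u n) \<longlonglongrightarrow> v n"
proof -
  obtain w where w: "\<And>j. j \<ge> 1 \<Longrightarrow> \<rho> (j * \<kappa>) \<noteq> 0 \<Longrightarrow> (u, w j) \<in> conj_sum j \<kappa>"
    and lim: "ell2_tendsto (\<lambda>M n. \<Sum>j=1..M. complex_of_real (\<rho> (j * \<kappa>)) * w j n) v"
    and v: "v \<in> ell2"
    using assms unfolding lin_comb_def by auto
  have summand: "(\<lambda>n. complex_of_real (\<rho> (j * \<kappa>)) * w j n) \<in> ell2 \<and>
      complex_of_real (\<rho> (j * \<kappa>)) * w j n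
      = complex_of_real (\<rho> (j * \<kappa>)) * conj_core_sum j \<kappa> u n" if "j \<ge> 1" for j n
    using conj_sum_pointwise[OF w[OF that]] by (cases "\<rho> (j * \<kappa>) = 0") auto
  have "(\<lambda>M. \<Sum>j=1..M. complex_of_real (\<rho> (j * \<kappa>)) * w j n) \<longlonglongrightarrow> v n"
    using summand v by (intro ell2_tendsto_pointwise[OF lim] ell2_sum) auto
  moreover have "(\<Sum>j=1..M. complex_of_real (\<rho> (j * \<kappa>)) * w j n)
      = (\<Sum>j=1..M. complex_of_real (\<rho> (j * \<kappa>)) * conj_core_sum j \<kappa> u n)" for M
    using summand by (intro sum.cong) auto
  ultimately show ?thesis by simp
qed

definition unit_vec :: "int ^ 2 \<Rightarrow> lattice_fun" where
  "unit_vec a n = (if n = a then 1 else 0)"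

lemma unit_vec_compact_supp: "unit_vec a \<in> compact_supp"
  by (simp add: compact_supp_def unit_vec_def)

lemma inner_unit_vec: "ell2_inner (unit_vec a) v = v a"
proof -
  have "ell2_inner (unit_vec a) v = (\<Sum>\<^sub>\<infinity>n\<in>{a}. v n)"
    unfolding ell2_inner_def unit_vec_def by (rule infsum_cong_neutral) auto
  then show ?thesis by simp
qed

locale conjugate_commutator =
  fixes \<kappa> :: nat and \<rho> :: "nat \<Rightarrow> real" and A :: "(lattice_fun \<times> lattice_fun) set"
    and C :: "lattice_fun \<Rightarrow> lattice_fun"
  assumes kappa: "\<kappa> \<ge> 1"
    and A_conj: "conjugate_operator \<kappa> \<rho> A"
    and C_comm: "Laplacian_commutator A C"
begin

lemma lin_comb_subset: "lin_comb \<rho> \<kappa> \<subseteq> A"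
proof
  fix p assume p: "p \<in> lin_comb \<rho> \<kappa>"
  obtain u v where [simp]: "p = (u, v)" by (cases p)
  have "u \<in> ell2" "v \<in> ell2" using p by (auto simp: lin_comb_def)
  moreover have "ell2_tendsto (\<lambda>k. x) x" for x :: lattice_fun
    by (simp add: ell2_tendsto_def ell2_norm_def)
  ultimately have "p \<in> op_closure (lin_comb \<rho> \<kappa>)"
    using p unfolding op_closure_def
    by simp (rule exI[of _ "\<lambda>k. u"], simp, rule exI[of _ "\<lambda>k. v"], simp)
  then show "p \<in> A" using A_conj by (simp add: conjugate_operator_def)
qed

text \<open>An adjoint of a densely defined operator is single valued; testing against the unit vectors, which
lie in the domain, is enough.\<close>

lemma A_functional:
  assumes "(u, v) \<in> A" "(u, v') \<in> A"
  shows "v = v'"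
proof
  fix a
  obtain y where y: "(unit_vec a, y) \<in> A"
    using A_conj lin_comb_subset unit_vec_compact_supp[of a] unfolding conjugate_operator_def by blast
  have "A = op_adjoint A"
    using A_conj unfolding conjugate_operator_def self_adjoint_op_def by blast
  then have "ell2_inner u y = ell2_inner w (unit_vec a)" if "(u, w) \<in> A" for w
    using that y unfolding op_adjoint_def by blast
  then have "ell2_inner v (unit_vec a) = ell2_inner v' (unit_vec a)"
    using assms by metis
  from arg_cong[OF this, of cnj] show "v a = v' a"
    by (simp add: ell2_inner_cnj inner_unit_vec)
qed

lemma A_pointwise:
  assumes "u \<in> compact_supp" "(u, v) \<in> A"
  shows "(\<lambda>M. \<Sum>j=1..M. complex_of_real (\<rho> (j * \<kappa>)) * conj_core_sum j \<kappa> u n) \<longlonglongrightarrow> v n"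
proof -
  obtain v' where v': "(u, v') \<in> lin_comb \<rho> \<kappa>"
    using A_conj assms(1) unfolding conjugate_operator_def by blast
  then have "v = v'" using A_functional assms(2) lin_comb_subset by blast
  then show ?thesis using lin_comb_pointwise[OF v'] by simp
qed

text \<open>On finitely supported functions the commutator of the sum is the sum of the commutators: single
valuedness identifies the values of \<open>A\<close> at \<open>u\<close> and at \<open>\<Delta>u\<close> with the pointwise sums of the series.\<close>

lemma C_pointwise:
  assumes u: "u \<in> compact_supp"
  shows "(\<lambda>M. \<Sum>j=1..M. complex_of_real (\<rho> (j * \<kappa>)) * commutator_term (j * \<kappa>) u n) \<longlonglongrightarrow> C u n"
proof -
  obtain v w where v: "(u, v) \<in> A" and w: "(Laplacian u, w) \<in> A"
    and Cu: "C u = (\<lambda>n. Laplacian (\<lambda>m. \<i> * v m) n - \<i> * w n)"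
    using C_comm u unfolding Laplacian_commutator_def by blast
  let ?S = "\<lambda>M f n. \<Sum>j=1..M. complex_of_real (\<rho> (j * \<kappa>)) * conj_core_sum j \<kappa> f n"
  have "(\<lambda>M. Laplacian (\<lambda>m. \<i> * ?S M u m) n - \<i> * ?S M (Laplacian u) n) \<longlonglongrightarrow> C u n"
    unfolding Cu Laplacian_def[of "\<lambda>m. \<i> * _ m"] shift_def
    by (intro tendsto_intros A_pointwise[OF u v] A_pointwise[OF Laplacian_compact_supp[OF u] w])
  moreover have "Laplacian (\<lambda>m. \<i> * ?S M u m) n - \<i> * ?S M (Laplacian u) n
      = (\<Sum>j=1..M. complex_of_real (\<rho> (j * \<kappa>)) * commutator_term (j * \<kappa>) u n)" for M
  proof -
    have "Laplacian (\<lambda>m. \<i> * ?S M u m) n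
        = (\<Sum>j=1..M. complex_of_real (\<rho> (j * \<kappa>)) * (\<i> * Laplacian (conj_core_sum j \<kappa> u) n))"
      unfolding Laplacian_def shift_def
      by (simp add: sum_2 sum_distrib_left sum.distrib algebra_simps)
    then show ?thesis
      unfolding conj_core_commutator[symmetric]
      by (simp add: sum_distrib_left sum_subtractf algebra_simps)
  qed
  ultimately show ?thesis by simp
qed

text \<open>Applied to the unit vector at the origin, the series has modulus \<open>\<bar>\<rho>(j\<kappa>)\<bar> j\<kappa>/4\<close> at the point \<open>j\<kappa>\<close> of
the first axis, and these values are square summable. The bound \<open>2xy \<le> x\<^sup>2 + y\<^sup>2\<close> with \<open>y = 1/j\<close>
turns this into absolute summability of the coefficients.\<close>

lemma rho_summable: "summable (\<lambda>j. \<bar>\<rho> (Suc j * \<kappa>)\<bar>)"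
proof -
  define p where "p j = axis (1 :: 2) (int (j * \<kappa>))" for j
  obtain v where v: "(unit_vec 0, v) \<in> lin_comb \<rho> \<kappa>"
    using A_conj unit_vec_compact_supp[of 0] unfolding conjugate_operator_def by blast
  have vp: "cmod (v (p j)) = \<bar>\<rho> (j * \<kappa>)\<bar> * real (j * \<kappa>) / 4" if "j \<ge> 1" for j
  proof -
    have core: "conj_core_sum l \<kappa> (unit_vec 0) (p j)
        = (if l = j then of_nat (j * \<kappa>) / (4 * \<i>) else 0)" if "l \<ge> 1" for l
    proof -
      have "l * \<kappa> > 0" "j * \<kappa> > 0" using that \<open>j \<ge> 1\<close> kappa by auto
      then have "int (j * \<kappa>) + int (l * \<kappa>) \<noteq> 0" "int (l * \<kappa>) + int (j * \<kappa>) \<noteq> 0"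
        by linarith+
      then show ?thesis
        using kappa
        by (auto simp: conj_core_sum_def conj_core_explicit sum_2 p_def unit_vec_def axis_def
            vec_eq_iff forall_2 simp flip: of_nat_mult)
    qed
    have "(\<lambda>M. \<Sum>l=1..M. complex_of_real (\<rho> (l * \<kappa>)) * conj_core_sum l \<kappa> (unit_vec 0) (p j))
        \<longlonglongrightarrow> complex_of_real (\<rho> (j * \<kappa>)) * of_nat (j * \<kappa>) / (4 * \<i>)"
    proof (rule tendsto_eventually, rule eventually_sequentiallyI)
      fix M assume "j \<le> M"
      have "(\<Sum>l=1..M. complex_of_real (\<rho> (l * \<kappa>)) * conj_core_sum l \<kappa> (unit_vec 0) (p j))
          = (\<Sum>l=1..M. if l = j then complex_of_real (\<rho> (j * \<kappa>)) * of_nat (j * \<kappa>) / (4 * \<i>) else 0)"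
        by (intro sum.cong) (auto simp: core)
      also have "\<dots> = complex_of_real (\<rho> (j * \<kappa>)) * of_nat (j * \<kappa>) / (4 * \<i>)"
        using \<open>j \<le> M\<close> \<open>j \<ge> 1\<close> by simp
      finally show "(\<Sum>l=1..M. complex_of_real (\<rho> (l * \<kappa>)) * conj_core_sum l \<kappa> (unit_vec 0) (p j))
          = complex_of_real (\<rho> (j * \<kappa>)) * of_nat (j * \<kappa>) / (4 * \<i>)" .
    qed
    then have "v (p j) = complex_of_real (\<rho> (j * \<kappa>)) * of_nat (j * \<kappa>) / (4 * \<i>)"
      by (rule LIMSEQ_unique[OF lin_comb_pointwise[OF v]])
    then show ?thesis by (simp add: norm_mult norm_divide)
  qed
  have inj: "inj (\<lambda>j. p (Suc j))"
    using kappa by (auto simp: inj_def p_def axis_def vec_eq_iff forall_2)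
  have "v \<in> ell2" using v by (simp add: lin_comb_def)
  then have "(\<lambda>n. (cmod (v n))\<^sup>2) summable_on range (\<lambda>j. p (Suc j))"
    unfolding ell2_def by (auto intro: summable_on_subset_banach)
  then have "(\<lambda>j. (cmod (v (p (Suc j))))\<^sup>2) summable_on UNIV"
    by (rule iffD1[OF summable_on_reindex[OF inj], unfolded o_def])
  then have s: "summable (\<lambda>j. (cmod (v (p (Suc j))))\<^sup>2)"
    by (rule summable_on_imp_summable)
  have s2: "summable (\<lambda>j. inverse (real (Suc j) ^ 2))"
    by (subst summable_Suc_iff) (rule inverse_power_summable, simp)
  have "summable (\<lambda>j. 2 * (4 * (cmod (v (p (Suc j))))\<^sup>2 + inverse (real (Suc j) ^ 2)))"
    using s s2 by (intro summable_mult summable_add)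
  then show ?thesis
  proof (rule summable_comparison_test'[where N = 0])
    fix j
    define a b x where "a = \<bar>\<rho> (Suc j * \<kappa>)\<bar>" and "b = real (Suc j)"
      and "x = cmod (v (p (Suc j)))"
    have b: "b > 0" "0 \<le> a" by (auto simp: a_def b_def)
    have x: "x = a * (b * real \<kappa>) / 4" unfolding x_def a_def b_def using vp[of "Suc j"] by (simp add: algebra_simps)
    have "a * b * 1 \<le> a * b * real \<kappa>" using kappa b by (intro mult_left_mono) auto
    then have "a * b \<le> 4 * x" by (simp add: x)
    then have "a \<le> 2 * (2 * x) * (1 / b)" using b by (simp add: field_simps)
    also have "\<dots> \<le> (2 * x)\<^sup>2 + (1 / b)\<^sup>2" by (rule sum_squares_bound)
    also have "\<dots> \<le> 2 * ((2 * x)\<^sup>2 + (1 / b)\<^sup>2)" by simp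
    also have "\<dots> = 2 * (4 * x\<^sup>2 + inverse (b ^ 2))"
      by (simp add: power_mult_distrib power_divide inverse_eq_divide)
    finally show "norm \<bar>\<rho> (Suc j * \<kappa>)\<bar> \<le> 2 * (4 * (cmod (v (p (Suc j))))\<^sup>2 + inverse (real (Suc j) ^ 2))"
      by (simp add: a_def b_def x_def)
  qed
qed

end


section \<open>The symbol of the commutator\<close>

lemma chebyshev_U_cos: "poly (chebyshev_U n) (cos a) * sin a = sin (real (Suc n) * a)"
proof (induction n rule: chebyshev_U.induct)
  case 2
  then show ?case using sin_double[of a] by (simp add: algebra_simps)
next
  case (3 n)
  have "sin (real (Suc (Suc (Suc n))) * a) + sin (real (Suc n) * a)
      = 2 * cos a * sin (real (Suc (Suc n)) * a)"
    using sin_add[of "real (Suc (Suc n)) * a" a] sin_diff[of "real (Suc (Suc n)) * a" a]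
    by (simp add: algebra_simps)
  with 3 show ?case by (simp add: algebra_simps)
qed simp

lemma g_fun_cos:
  assumes "m \<ge> 1"
  shows "g_fun m (\<chi> i. cos (\<theta> $ i)) = (\<Sum>i\<in>UNIV. sin (\<theta> $ i) * sin (real m * \<theta> $ i))"
proof -
  have "(1 - (cos a)\<^sup>2) * poly (chebyshev_U (m - 1)) (cos a) = sin a * sin (real m * a)" for a
    using chebyshev_U_cos[of "m - 1" a] assms
    unfolding sin_squared_eq[symmetric] unfolding power2_eq_square by (simp add: mult_ac)
  then show ?thesis by (simp add: g_fun_def)
qed

lemma inner_commutator_term:
  assumes "u \<in> ell2"
  shows "ell2_inner u (commutator_term m u) = (\<Sum>i\<in>UNIV. 1 / 4 *
     (ell2_inner u (shift i (int m - 1) u) + ell2_inner u (shift i (1 - int m) u)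
      - ell2_inner u (shift i (int m + 1) u) - ell2_inner u (shift i (- int m - 1) u)))"
  unfolding commutator_term_def[abs_def] sum_2
  using assms by (simp add: ell2_inner_linear del: times_divide_eq_left mult_1)

lemma inner_commutator_term_bound:
  assumes u: "u \<in> ell2" "ell2_norm u = 1"
  shows "cmod (ell2_inner u (commutator_term m u)) \<le> 2"
proof -
  have b: "cmod (ell2_inner u (shift i k u)) \<le> 1" for i k
    using ell2_Cauchy_Schwarz[OF u(1) shift_ell2[OF u(1), of i k]] u(2) by (simp add: shift_norm)
  have "cmod (1 / 4 * (a + b - c - d)) \<le> 1"
    if "cmod a \<le> 1" "cmod b \<le> 1" "cmod c \<le> 1" "cmod d \<le> 1" for a b c d
    using that norm_triangle_ineq[of a b] norm_triangle_ineq4[of "a + b" c]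
      norm_triangle_ineq4[of "a + b - c" d] unfolding norm_mult by simp
  then have "cmod (ell2_inner u (commutator_term m u)) \<le> (\<Sum>i\<in>(UNIV :: 2 set). 1)"
    unfolding inner_commutator_term[OF u(1)] by (intro sum_norm_le) (use b in blast)
  then show ?thesis by simp
qed

lemma inner_commutator_term_limit:
  assumes "approx_plane_wave \<theta> u" "m \<ge> 1"
  shows "(\<lambda>L. ell2_inner (u L) (commutator_term m (u L)))
    \<longlonglongrightarrow> complex_of_real (g_fun m (\<chi> i. cos (\<theta> $ i)))"
proof -
  note u = approx_plane_waveD[OF assms(1)]
  have val: "(1 / 4 * (cis (- (of_int (int m - 1) * a)) + cis (- (of_int (1 - int m) * a))
      - cis (- (of_int (int m + 1) * a)) - cis (- (of_int (- int m - 1) * a))))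
    = complex_of_real (sin a * sin (real m * a))" for a
  proof -
    have "cos (real m * a - a) - cos (real m * a + a) = 2 * (sin a * sin (real m * a))"
      by (simp add: cos_add cos_diff)
    moreover have "cos (a - real m * a) = cos (real m * a - a)"
      using cos_minus[of "a - real m * a"] by simp
    moreover have "sin (a - real m * a) = - sin (real m * a - a)"
      using sin_minus[of "real m * a - a"] by simp
    moreover have "cos (- a - real m * a) = cos (real m * a + a)"
      "sin (- a - real m * a) = - sin (real m * a + a)"
      unfolding diff_conv_add_uminus minus_add_distrib[symmetric] cos_minus sin_minus
      by (simp_all add: add.commute)
    ultimately show ?thesis
      by (simp add: complex_eq_iff algebra_simps)
  qed
  have "(\<lambda>L. ell2_inner (u L) (commutator_term m (u L))) \<longlonglongrightarrow>
    (\<Sum>i\<in>UNIV. 1 / 4 * (cis (- (of_int (int m - 1) * \<theta> $ i)) + cis (- (of_int (1 - int m) * \<theta> $ i))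
      - cis (- (of_int (int m + 1) * \<theta> $ i)) - cis (- (of_int (- int m - 1) * \<theta> $ i))))"
    unfolding inner_commutator_term[OF u(2)]
    by (intro tendsto_intros approx_plane_wave_inner_shift assms(1))
  then show ?thesis unfolding val g_fun_cos[OF assms(2)] by simp
qed

context conjugate_commutator
begin

definition commutator_symbol :: "real ^ 2 \<Rightarrow> real" where
  "commutator_symbol x = (\<Sum>j. \<rho> (Suc j * \<kappa>) * g_fun (Suc j * \<kappa>) x)"

lemma C_form_sums:
  assumes u: "u \<in> compact_supp"
  shows "(\<lambda>j. complex_of_real (\<rho> (Suc j * \<kappa>)) * ell2_inner u (commutator_term (Suc j * \<kappa>) u))
    sums ell2_inner u (C u)"
proof -
  define S where "S = {n. u n \<noteq> 0}"
  have fin: "finite S" using u by (simp add: S_def compact_supp_def)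
  have inner: "ell2_inner u w = (\<Sum>n\<in>S. cnj (u n) * w n)" for w
  proof -
    have "ell2_inner u w = (\<Sum>\<^sub>\<infinity>n\<in>S. cnj (u n) * w n)"
      unfolding ell2_inner_def by (rule infsum_cong_neutral) (auto simp: S_def)
    then show ?thesis using fin by simp
  qed
  have "(\<lambda>M. \<Sum>n\<in>S. cnj (u n) * (\<Sum>j=1..M. complex_of_real (\<rho> (j * \<kappa>)) * commutator_term (j * \<kappa>) u n))
      \<longlonglongrightarrow> ell2_inner u (C u)"
    unfolding inner by (intro tendsto_intros C_pointwise u)
  moreover have "(\<Sum>n\<in>S. cnj (u n) * (\<Sum>j=1..M. complex_of_real (\<rho> (j * \<kappa>)) * commutator_term (j * \<kappa>) u n))
      = (\<Sum>j<M. complex_of_real (\<rho> (Suc j * \<kappa>)) * ell2_inner u (commutator_term (Suc j * \<kappa>) u))" for M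
  proof -
    have "(\<Sum>n\<in>S. cnj (u n) * (\<Sum>j=1..M. complex_of_real (\<rho> (j * \<kappa>)) * commutator_term (j * \<kappa>) u n))
        = (\<Sum>j=1..M. complex_of_real (\<rho> (j * \<kappa>)) * ell2_inner u (commutator_term (j * \<kappa>) u))"
      unfolding inner sum_distrib_left by (subst sum.swap) (simp add: mult_ac)
    then show ?thesis by (simp add: sum.atLeast1_atMost_eq)
  qed
  ultimately show ?thesis by (simp add: sums_def)
qed

text \<open>Absolute summability of the coefficients allows the limit to be taken term by term, by Tannery's
theorem, since every single term is bounded by \<open>2 \<bar>\<rho>(j\<kappa>)\<bar>\<close>.\<close>

lemma C_form_limit:
  assumes u: "approx_plane_wave \<theta> u"
  shows "(\<lambda>L. ell2_inner (u L) (C (u L)))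
    \<longlonglongrightarrow> complex_of_real (commutator_symbol (\<chi> i. cos (\<theta> $ i)))"
    and "summable (\<lambda>j. \<rho> (Suc j * \<kappa>) * g_fun (Suc j * \<kappa>) (\<chi> i. cos (\<theta> $ i)))"
proof -
  define a where "a j L = complex_of_real (\<rho> (Suc j * \<kappa>)) *
    ell2_inner (u L) (commutator_term (Suc j * \<kappa>) (u L))" for j L
  define b where "b j = complex_of_real (\<rho> (Suc j * \<kappa>) * g_fun (Suc j * \<kappa>) (\<chi> i. cos (\<theta> $ i)))" for j
  have "(a j \<longlongrightarrow> b j) sequentially" for j
    unfolding a_def b_def of_real_mult using kappa
    by (intro tendsto_intros inner_commutator_term_limit u) simp
  moreover have "\<forall>\<^sub>F (j, L) in at_top \<times>\<^sub>F sequentially. norm (a j L) \<le> \<bar>\<rho> (Suc j * \<kappa>)\<bar> * 2"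
    unfolding a_def norm_mult norm_of_real
    by (intro always_eventually allI case_prodI2 mult_left_mono inner_commutator_term_bound
        approx_plane_waveD[OF u]) auto
  moreover have "summable (\<lambda>j. \<bar>\<rho> (Suc j * \<kappa>)\<bar> * 2)"
    by (intro summable_mult2 rho_summable)
  ultimately have *: "summable (\<lambda>j. norm (b j))" "(\<lambda>L. \<Sum>j. a j L) \<longlonglongrightarrow> suminf b"
    using tannerys_theorem[of a b sequentially "\<lambda>j. \<bar>\<rho> (Suc j * \<kappa>)\<bar> * 2"] by auto
  have "summable b" using *(1) by (rule summable_norm_cancel)
  then show s: "summable (\<lambda>j. \<rho> (Suc j * \<kappa>) * g_fun (Suc j * \<kappa>) (\<chi> i. cos (\<theta> $ i)))"
    unfolding b_def summable_complex_of_real .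
  have "suminf b = complex_of_real (commutator_symbol (\<chi> i. cos (\<theta> $ i)))"
    unfolding b_def commutator_symbol_def by (rule suminf_of_real[OF s, symmetric])
  moreover have "(\<Sum>j. a j L) = ell2_inner (u L) (C (u L))" for L
    unfolding a_def by (intro sums_unique[symmetric] C_form_sums approx_plane_waveD[OF u])
  ultimately show "(\<lambda>L. ell2_inner (u L) (C (u L)))
    \<longlonglongrightarrow> complex_of_real (commutator_symbol (\<chi> i. cos (\<theta> $ i)))"
    using *(2) by simp
qed

text \<open>Insert truncated plane waves \<open>u\<close> of energy \<open>E\<close> into the Mourre estimate. If \<open>e\<close> is the norm of
\<open>u - P I u\<close>, then \<open>\<parallel>P I u\<parallel>\<^sup>2 = 1 - e\<^sup>2\<close>, and replacing \<open>P I u\<close> by \<open>u\<close> in the form of \<open>C\<close>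
costs at most \<open>2 K e\<close>; finally \<open>e\<close> tends to zero.\<close>

lemma commutator_symbol_ge:
  assumes P: "spectral_measure_of Laplacian P" and I: "open I" "E \<in> I"
    and mourre: "op_le (\<lambda>u n. complex_of_real \<gamma> * P I u n) (\<lambda>u. P I (C (P I u)))"
    and E: "E = (\<Sum>i\<in>UNIV. cos (\<theta> $ i))"
  shows "\<gamma> \<le> commutator_symbol (\<chi> i. cos (\<theta> $ i))"
proof -
  interpret spectral_resolution Laplacian P
    by unfold_locales (rule Laplacian_bounded, rule P)
  have Ib: "I \<in> sets borel" using I by simp
  have C: "bounded_op C" using C_comm by (simp add: Laplacian_commutator_def)
  obtain K where K: "K > 0" "\<And>u. u \<in> ell2 \<Longrightarrow> ell2_norm (C u) \<le> K * ell2_norm u"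
    using bounded_op_bound[OF C] by blast
  obtain K' where K': "K' > 0" "\<And>u. u \<in> ell2 \<Longrightarrow> ell2_norm (\<lambda>n. u n - P I u n)
      \<le> K' * ell2_norm (\<lambda>n. Laplacian u n - complex_of_real E * u n)"
    using spectral_projection_residual[OF I] by blast
  obtain u where wave: "approx_plane_wave \<theta> u" using approx_plane_wave_exists by blast
  note u = approx_plane_waveD[OF wave]
  define e where "e L = ell2_norm (\<lambda>n. u L n - P I (u L) n)" for L
  have e: "e \<longlonglongrightarrow> 0"
  proof (rule tendsto_sandwich[OF always_eventually always_eventually tendsto_const])
    show "\<forall>L. e L \<le> K' * ell2_norm (\<lambda>n. Laplacian (u L) n - complex_of_real E * u L n)"
      unfolding e_def using K'(2)[OF u(2)] by blast
    show "(\<lambda>L. K' * ell2_norm (\<lambda>n. Laplacian (u L) n - complex_of_real E * u L n)) \<longlonglongrightarrow> 0"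
      using tendsto_mult_left[OF approx_plane_wave_Laplacian[OF wave E], of K'] by simp
  qed (simp add: e_def)
  have "\<gamma> * (1 - (e L)\<^sup>2) - 2 * K * e L \<le> Re (ell2_inner (u L) (C (u L)))" for L
  proof -
    define x v d where "x = u L" and "v = P I x" and "d = (\<lambda>n. x n - v n)"
    have x: "x \<in> ell2" "ell2_norm x = 1" using u by (auto simp: x_def)
    have v: "v \<in> ell2" using x Ib by (simp add: v_def)
    have d: "d \<in> ell2" "ell2_norm d = e L" using x v by (auto simp: d_def e_def v_def x_def)
    have dP: "d = P (- I) x"
      using fun_cong[OF P_decompose[OF Ib x(1)]] by (auto simp: d_def v_def algebra_simps)
    have nv: "(ell2_norm v)\<^sup>2 = 1 - (e L)\<^sup>2"
      using P_complement_norm[OF Ib x(1)] x(2) d(2) by (simp flip: dP v_def)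
    then have "(ell2_norm v)\<^sup>2 \<le> 1\<^sup>2" by simp
    then have nv1: "ell2_norm v \<le> 1" by (rule power2_le_imp_le) simp
    have "0 \<le> Re (ell2_inner x (\<lambda>n. P I (C v) n - complex_of_real \<gamma> * v n))"
      using mourre x(1) unfolding op_le_def v_def by blast
    also have "ell2_inner x (\<lambda>n. P I (C v) n - complex_of_real \<gamma> * v n)
        = ell2_inner v (C v) - complex_of_real (\<gamma> * (ell2_norm v)\<^sup>2)"
      using x v C Ib P_symmetric[OF Ib x(1), of "C v"] inner_P[OF Ib x(1)]
      by (simp add: ell2_inner_linear flip: v_def)
    finally have "\<gamma> * (1 - (e L)\<^sup>2) \<le> Re (ell2_inner v (C v))"
      by (simp add: nv flip: of_real_power)
    moreover have "ell2_inner x (C x) = ell2_inner v (C v) + ell2_inner d (C v) + ell2_inner x (C d)"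
      using x v d C unfolding d_def bounded_op_diff[OF C x(1) v]
      by (simp add: ell2_inner_linear)
    moreover have "cmod (ell2_inner d (C v)) \<le> K * e L"
    proof -
      have "cmod (ell2_inner d (C v)) \<le> ell2_norm d * ell2_norm (C v)"
        using d v C by (intro ell2_Cauchy_Schwarz) auto
      also have "\<dots> \<le> ell2_norm d * (K * 1)"
        using K(2)[OF v] mult_left_mono[OF nv1, of K] K(1)
        by (intro mult_left_mono ell2_norm_nonneg) linarith
      finally show ?thesis using d by (simp add: mult.commute)
    qed
    moreover have "cmod (ell2_inner x (C d)) \<le> K * e L"
    proof -
      have "cmod (ell2_inner x (C d)) \<le> ell2_norm x * ell2_norm (C d)"
        using d x C by (intro ell2_Cauchy_Schwarz) auto
      also have "\<dots> \<le> 1 * (K * ell2_norm d)"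
        using K(2)[OF d(1)] x by simp
      finally show ?thesis using d by simp
    qed
    ultimately show ?thesis
      using abs_Re_le_cmod[of "ell2_inner d (C v)"] abs_Re_le_cmod[of "ell2_inner x (C d)"]
      by (simp add: x_def)
  qed
  moreover have "(\<lambda>L. \<gamma> * (1 - (e L)\<^sup>2) - 2 * K * e L) \<longlonglongrightarrow> \<gamma> * (1 - 0\<^sup>2) - 2 * K * 0"
    by (intro tendsto_intros e)
  moreover have "(\<lambda>L. Re (ell2_inner (u L) (C (u L)))) \<longlonglongrightarrow> commutator_symbol (\<chi> i. cos (\<theta> $ i))"
    using tendsto_Re[OF C_form_limit(1)[OF wave]] by simp
  ultimately have "\<gamma> * (1 - 0\<^sup>2) - 2 * K * 0 \<le> commutator_symbol (\<chi> i. cos (\<theta> $ i))"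
    by (intro LIMSEQ_le) auto
  then show ?thesis by simp
qed

end

section \<open>Relations on the energy surface exclude Mourre estimates\<close>

lemma energy_surface_cos:
  assumes "x \<in> energy_surface E"
  obtains \<theta> :: "real ^ 2" where "x = (\<chi> i. cos (\<theta> $ i))" "E = (\<Sum>i\<in>UNIV. cos (\<theta> $ i))"
proof (rule that[of "\<chi> i. arccos (x $ i)"])
  show "x = (\<chi> i. cos ((\<chi> i. arccos (x $ i)) $ i))" "E = (\<Sum>i\<in>UNIV. cos ((\<chi> i. arccos (x $ i)) $ i))"
    using assms by (auto simp: energy_surface_def vec_eq_iff)
qed

lemma energy_surface_spectrum:
  assumes "x \<in> energy_surface E"
  shows "E \<in> sigma_Laplacian"
  using energy_surface_cos[OF assms] sum_cos_in_spectrum by metis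

text \<open>Under a strict Mourre estimate the symbol would be positive at all the points \<open>x q\<close>, whereas summing
the relation between the \<open>g_fun\<close> against \<open>\<rho>\<close> makes it nonpositive at \<open>x m\<close>.\<close>

theorem Theta_order_subset_Theta:
  assumes "\<kappa> \<ge> 1"
  shows "Theta_order m \<kappa> \<subseteq> Theta \<kappa>"
proof
  fix E assume "E \<in> Theta_order m \<kappa>"
  then obtain x \<omega> where E: "E \<in> sigma_Laplacian"
    and x: "\<And>q. q \<le> m \<Longrightarrow> x q \<in> energy_surface E" and \<omega>: "\<And>q. q < m \<Longrightarrow> \<omega> q \<le> 0"
    and rel: "\<And>j. j \<ge> 1 \<Longrightarrow> g_fun (j * \<kappa>) (x m) = (\<Sum>q<m. \<omega> q * g_fun (j * \<kappa>) (x q))"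
    unfolding Theta_order_def by auto
  have "E \<notin> mu_set \<kappa>"
  proof
    assume "E \<in> mu_set \<kappa>"
    then obtain \<rho> A C P I \<gamma> where *: "conjugate_operator \<kappa> \<rho> A" "Laplacian_commutator A C"
      "spectral_measure_of Laplacian P" "open I" "E \<in> I" "\<gamma> > 0"
      "op_le (\<lambda>u n. complex_of_real \<gamma> * P I u n) (\<lambda>u. P I (C (P I u)))"
      unfolding mu_set_def by blast
    interpret conjugate_commutator \<kappa> \<rho> A C
      by unfold_locales (use assms * in auto)
    have sum: "summable (\<lambda>j. \<rho> (Suc j * \<kappa>) * g_fun (Suc j * \<kappa>) (x q))"
      and pos: "commutator_symbol (x q) > 0" if q: "q \<le> m" for q
    proof -
      obtain \<theta> where \<theta>: "x q = (\<chi> i. cos (\<theta> $ i))" "E = (\<Sum>i\<in>UNIV. cos (\<theta> $ i))"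
        using energy_surface_cos[OF x[OF q]] by blast
      show "summable (\<lambda>j. \<rho> (Suc j * \<kappa>) * g_fun (Suc j * \<kappa>) (x q))"
        unfolding \<theta>(1) using C_form_limit(2) approx_plane_wave_exists by blast
      show "commutator_symbol (x q) > 0"
        using commutator_symbol_ge[OF *(3,4,5,7) \<theta>(2)] *(6) unfolding \<theta>(1) by simp
    qed
    have "commutator_symbol (x m)
        = (\<Sum>j. \<Sum>q<m. \<omega> q * (\<rho> (Suc j * \<kappa>) * g_fun (Suc j * \<kappa>) (x q)))"
      unfolding commutator_symbol_def
      by (subst rel) (simp_all add: sum_distrib_left mult_ac)
    also have "\<dots> = (\<Sum>q<m. \<Sum>j. \<omega> q * (\<rho> (Suc j * \<kappa>) * g_fun (Suc j * \<kappa>) (x q)))"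
      by (intro suminf_sum summable_mult sum) simp
    also have "\<dots> = (\<Sum>q<m. \<omega> q * commutator_symbol (x q))"
      unfolding commutator_symbol_def by (intro sum.cong refl suminf_mult sum) simp
    also have "\<dots> \<le> 0"
      using \<omega> pos by (intro sum_nonpos) (simp add: mult_nonpos_nonneg less_imp_le)
    finally show False using pos[of m] by simp
  qed
  with E show "E \<in> Theta \<kappa>" by (simp add: Theta_def)
qed


section \<open>Chains of points on the energy surface\<close>

text \<open>The reflection \<open>a \<mapsto> 2\<tau> - a\<close> changes the sign of \<open>sin (j\<kappa>a)\<close> for all \<open>j\<close> simultaneously. Hence
\<open>g(x q) = sin (a (q + 1)) S\<^sub>j(q + 1) - sin (2\<tau> - a q) S\<^sub>j(q)\<close> with both sine factors nonnegative, and
these relations are solved successively for \<open>S\<^sub>j(1), \<dots>, S\<^sub>j(n)\<close> with nonnegative coefficients.\<close>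

lemma chain_threshold:
  fixes a :: "nat \<Rightarrow> real"
  assumes \<kappa>: "\<kappa> \<ge> 2" and \<tau>: "\<tau> = pi / real \<kappa>"
    and a0: "a 0 = 0" and a: "\<And>q. 0 < q \<Longrightarrow> q \<le> n \<Longrightarrow> 0 < a q \<and> a q \<le> \<tau>"
    and step: "\<And>q. q < n \<Longrightarrow> cos (2 * \<tau> - a q) + cos (a (Suc q)) = E"
    and last: "cos (2 * \<tau> - a n) + cos \<tau> = E \<or> 2 * cos (2 * \<tau> - a n) = E"
  shows "E \<in> Theta_order n \<kappa>"
proof -
  define S where "S j q = sin (real (j * \<kappa>) * a q)" for j q
  have reflect: "sin (real (j * \<kappa>) * (2 * \<tau> - a q)) = - S j q" for j q
  proof -
    have "real (j * \<kappa>) * (2 * \<tau> - a q) = 2 * real j * pi - real (j * \<kappa>) * a q"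
      using \<kappa> by (simp add: \<tau> algebra_simps)
    then show ?thesis by (simp only: S_def sin_diff sin_2npi cos_2npi mult_zero_left mult_1_right diff_0)
  qed
  \<comment> \<open>\<open>cos b\<close> is the second coordinate of the last point; \<open>k\<close> is 0 if \<open>b = \<tau>\<close> and 1 on the diagonal.\<close>
  obtain b k where b: "cos (2 * \<tau> - a n) + cos b = E"
    and k: "0 \<le> k" "\<And>j. sin b * sin (real (j * \<kappa>) * b) = - k * sin (2 * \<tau> - a n) * S j n"
  proof (cases "cos (2 * \<tau> - a n) + cos \<tau> = E")
    case True
    have "real (j * \<kappa>) * \<tau> = real j * pi" for j using \<kappa> by (simp add: \<tau>)
    then have "sin (real (j * \<kappa>) * \<tau>) = 0" for j by (simp only: sin_npi)
    then show thesis using that[of \<tau> 0] True by simp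
  next
    case False
    show thesis using reflect[of _ n] that[of "2 * \<tau> - a n" 1] False last by simp
  qed
  define \<theta> :: "nat \<Rightarrow> real ^ 2"
    where "\<theta> q = (\<chi> i. if i = 1 then 2 * \<tau> - a q else if q = n then b else a (Suc q))" for q
  define x :: "nat \<Rightarrow> real ^ 2" where "x q = (\<chi> i. cos (\<theta> q $ i))" for q
  have surface: "x q \<in> energy_surface E" if "q \<le> n" for q
    using step[of q] b that by (auto simp: energy_surface_def x_def \<theta>_def sum_2)
  have g: "g_fun (j * \<kappa>) (x q) = sin (a (Suc q)) * S j (Suc q) - sin (2 * \<tau> - a q) * S j q"
    if "q < n" "j \<ge> 1" for j q
    unfolding x_def using that \<kappa>
    by (subst g_fun_cos) (simp_all add: \<theta>_def sum_2 reflect[of j q, simplified] S_def)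
  have g_last: "g_fun (j * \<kappa>) (x n) = - (1 + k) * sin (2 * \<tau> - a n) * S j n" if "j \<ge> 1" for j
  proof -
    have "g_fun (j * \<kappa>) (x n) = sin (2 * \<tau> - a n) * sin (real (j * \<kappa>) * (2 * \<tau> - a n))
        + sin b * sin (real (j * \<kappa>) * b)"
      unfolding x_def using that \<kappa> by (subst g_fun_cos) (simp_all add: \<theta>_def sum_2)
    then show ?thesis unfolding k(2) reflect by (simp add: algebra_simps)
  qed
  have \<tau>_bounds: "0 < \<tau>" "2 * \<tau> \<le> pi"
    using \<kappa> by (auto simp: \<tau> field_simps)
  have a_bounds: "0 \<le> a q" "a q \<le> \<tau>" if "q \<le> n" for q
    using a[of q] a0 that \<tau>_bounds by (cases "q = 0"; force)+
  have sin_X: "0 \<le> sin (2 * \<tau> - a q)" if "q \<le> n" for q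
    using a_bounds[OF that] \<tau>_bounds by (intro sin_ge_zero) auto
  have "\<exists>c. (\<forall>p. 0 \<le> c p) \<and> (\<forall>j\<ge>1. S j q = (\<Sum>p<q. c p * g_fun (j * \<kappa>) (x p)))"
    if "q \<le> n" for q
    using that
  proof (induction q)
    case 0
    show ?case by (auto simp: S_def a0 intro: exI[of _ "\<lambda>_. 0"])
  next
    case (Suc q)
    then obtain c where c: "\<And>p. 0 \<le> c p" "\<And>j. j \<ge> 1 \<Longrightarrow> S j q = (\<Sum>p<q. c p * g_fun (j * \<kappa>) (x p))"
      by auto
    define s t where "s = sin (a (Suc q))" and "t = sin (2 * \<tau> - a q)"
    have s: "0 < s" unfolding s_def using a[of "Suc q"] Suc.prems \<tau>_bounds by (intro sin_gt_zero) auto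
    have t: "0 \<le> t" unfolding t_def using Suc.prems by (intro sin_X) simp
    define c' where "c' p = (if p < q then t * c p / s else 1 / s)" for p
    show ?case
    proof (intro exI[of _ c'] conjI allI impI)
      show "0 \<le> c' p" for p using s t c(1) by (simp add: c'_def)
      fix j :: nat assume j: "j \<ge> 1"
      have "g_fun (j * \<kappa>) (x q) = s * S j (Suc q) - t * S j q"
        using Suc.prems j by (simp add: g s_def t_def)
      then have "S j (Suc q) = t / s * S j q + 1 / s * g_fun (j * \<kappa>) (x q)"
        using s by (simp add: field_simps)
      also have "\<dots> = (\<Sum>p<Suc q. c' p * g_fun (j * \<kappa>) (x p))"
        by (simp add: c(2)[OF j] c'_def sum_distrib_left mult.assoc)
      finally show "S j (Suc q) = (\<Sum>p<Suc q. c' p * g_fun (j * \<kappa>) (x p))" .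
    qed
  qed
  from this[of n] obtain c where c: "\<And>p. 0 \<le> c p"
    "\<And>j. j \<ge> 1 \<Longrightarrow> S j n = (\<Sum>p<n. c p * g_fun (j * \<kappa>) (x p))" by auto
  define \<omega> where "\<omega> p = - ((1 + k) * sin (2 * \<tau> - a n) * c p)" for p
  have "\<omega> p \<le> 0" for p
    using k(1) sin_X[of n] c(1)[of p] by (simp add: \<omega>_def)
  moreover have "g_fun (j * \<kappa>) (x n) = (\<Sum>q<n. \<omega> q * g_fun (j * \<kappa>) (x q))" if "j \<ge> 1" for j
    unfolding g_last[OF that] c(2)[OF that] \<omega>_def sum_distrib_left
    by (intro sum.cong refl) (simp add: algebra_simps)
  ultimately show ?thesis
    using surface energy_surface_spectrum[OF surface[of n]] unfolding Theta_order_def by blast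
qed

section \<open>Chains of prescribed length\<close>

text \<open>With \<open>E = 1 + cos 2\<tau> - \<epsilon>\<close>, the next angle solves \<open>cos (2\<tau> - a) + cos a' = E\<close>. The maximum with \<open>cos \<tau>\<close>
freezes the chain at the angle \<open>\<tau>\<close> once it would leave \<open>[0, \<tau>]\<close>; the angles are then defined,
continuous and monotone for all \<open>\<epsilon> \<ge> 0\<close>.\<close>

primrec chain_angle :: "real \<Rightarrow> real \<Rightarrow> nat \<Rightarrow> real" where
  "chain_angle \<tau> \<epsilon> 0 = 0"
| "chain_angle \<tau> \<epsilon> (Suc q) =
     arccos (max (cos \<tau>) (1 + cos (2 * \<tau>) - \<epsilon> - cos (2 * \<tau> - chain_angle \<tau> \<epsilon> q)))"

locale angle_chain =
  fixes \<tau> :: real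
  assumes tau_pos: "0 < \<tau>" and tau_le: "\<tau> \<le> pi / 3"
begin

abbreviation angle :: "real \<Rightarrow> nat \<Rightarrow> real" where
  "angle \<epsilon> q \<equiv> chain_angle \<tau> \<epsilon> q"

text \<open>The second coordinate that the \<open>q\<close>-th point of the chain must have. The chain is genuine as long as
this is at least \<open>cos \<tau>\<close>.\<close>

definition height :: "real \<Rightarrow> nat \<Rightarrow> real" where
  "height \<epsilon> q = 1 + cos (2 * \<tau>) - \<epsilon> - cos (2 * \<tau> - angle \<epsilon> q)"

lemma angle_Suc: "angle \<epsilon> (Suc q) = arccos (max (cos \<tau>) (height \<epsilon> q))"
  by (simp add: height_def)

lemma tau_pi: "2 * \<tau> \<le> pi" using tau_pos tau_le by simp

lemma cos_tau: "1 / 2 \<le> cos \<tau>" "cos \<tau> < 1"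
proof -
  show "1 / 2 \<le> cos \<tau>"
    using cos_monotone_0_pi_le[of \<tau> "pi / 3"] tau_pos tau_le by (simp add: cos_60)
  show "cos \<tau> < 1"
    using cos_monotone_0_pi[of 0 \<tau>] tau_pos tau_pi by simp
qed

lemma cos_two_tau: "cos (2 * \<tau>) = 2 * (cos \<tau>)\<^sup>2 - 1"
  by (rule cos_double_cos)

lemma cos_tau_square: "(cos \<tau>)\<^sup>2 < cos \<tau>"
  using cos_tau by (simp add: power2_eq_square)

lemma angle_range:
  assumes "0 \<le> \<epsilon>"
  shows "0 \<le> angle \<epsilon> q" "angle \<epsilon> q \<le> \<tau>"
proof -
  have "0 \<le> angle \<epsilon> q \<and> angle \<epsilon> q \<le> \<tau>"
  proof (induction q)
    case (Suc q)
    have "cos (2 * \<tau>) \<le> cos (2 * \<tau> - angle \<epsilon> q)"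
      using Suc tau_pos tau_pi by (intro cos_monotone_0_pi_le) auto
    then have h: "height \<epsilon> q \<le> 1" using assms by (simp add: height_def)
    have "arccos (max (cos \<tau>) (height \<epsilon> q)) \<le> arccos (cos \<tau>)"
      using h cos_tau by (intro arccos_le_mono[THEN iffD2]) auto
    also have "arccos (cos \<tau>) = \<tau>" using tau_pos tau_pi by (intro arccos_cos) auto
    finally show ?case
      unfolding angle_Suc using h cos_tau by (auto intro!: arccos_lbound)
  qed (use tau_pos in simp)
  then show "0 \<le> angle \<epsilon> q" "angle \<epsilon> q \<le> \<tau>" by auto
qed

lemma height_le: "0 \<le> \<epsilon> \<Longrightarrow> height \<epsilon> q \<le> 1 - \<epsilon>"
  using cos_monotone_0_pi_le[of "2 * \<tau> - angle \<epsilon> q" "2 * \<tau>"] angle_range[of \<epsilon> q] tau_pos tau_pi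
  by (simp add: height_def)

lemma cos_angle_Suc:
  assumes "0 \<le> \<epsilon>"
  shows "cos (angle \<epsilon> (Suc q)) = max (cos \<tau>) (height \<epsilon> q)"
  unfolding angle_Suc using height_le[OF assms, of q] assms cos_tau by (intro cos_arccos) auto

text \<open>In a genuine chain the cosine of the angle is the preceding height, so the heights drop by at least
\<open>\<epsilon>\<close> per step. The reason is the inequality
\<open>cos (2\<tau> - a) + cos a = 2 cos \<tau> cos (\<tau> - a) \<ge> 2 cos\<^sup>2 \<tau> = 1 + cos 2\<tau>\<close>.\<close>

lemma height_le_cos_angle:
  assumes "0 \<le> \<epsilon>"
  shows "height \<epsilon> q \<le> cos (angle \<epsilon> q) - \<epsilon>"
proof -
  define a where "a = angle \<epsilon> q"
  have a: "0 \<le> a" "a \<le> \<tau>" using angle_range[OF assms] by (auto simp: a_def)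
  have "cos (2 * \<tau> - a) + cos a = 2 * cos \<tau> * cos (\<tau> - a)"
    using cos_plus_cos[of "2 * \<tau> - a" a] by (simp add: diff_divide_distrib)
  also have "\<dots> \<ge> 2 * cos \<tau> * cos \<tau>"
    using a tau_pi cos_tau by (intro mult_left_mono cos_monotone_0_pi_le) auto
  finally show ?thesis
    unfolding height_def a_def[symmetric] cos_two_tau by (simp add: power2_eq_square)
qed

lemma angle_mono:
  assumes "0 \<le> \<epsilon>" "\<epsilon> \<le> \<epsilon>'"
  shows "angle \<epsilon> q \<le> angle \<epsilon>' q"
proof (induction q)
  case (Suc q)
  have "cos (2 * \<tau> - angle \<epsilon> q) \<le> cos (2 * \<tau> - angle \<epsilon>' q)"
    using Suc angle_range[of \<epsilon> q] angle_range[of \<epsilon>' q] assms tau_pos tau_pi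
    by (intro cos_monotone_0_pi_le) auto
  then have "height \<epsilon>' q \<le> height \<epsilon> q" using assms by (simp add: height_def)
  then show ?case
    unfolding angle_Suc using height_le[of \<epsilon> q] height_le[of \<epsilon>' q] assms cos_tau
    by (intro arccos_le_mono[THEN iffD2]) auto
qed simp

lemma height_strict_antimono:
  assumes "0 \<le> \<epsilon>" "\<epsilon> < \<epsilon>'"
  shows "height \<epsilon>' q < height \<epsilon> q"
proof -
  have "cos (2 * \<tau> - angle \<epsilon> q) \<le> cos (2 * \<tau> - angle \<epsilon>' q)"
    using angle_mono[of \<epsilon> \<epsilon>' q] angle_range[of \<epsilon> q] angle_range[of \<epsilon>' q] assms tau_pos tau_pi
    by (intro cos_monotone_0_pi_le) auto
  then show ?thesis using assms by (simp add: height_def)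
qed

lemma angle_pos:
  assumes "0 < \<epsilon>"
  shows "0 < angle \<epsilon> (Suc q)"
proof -
  have "cos (angle \<epsilon> (Suc q)) < 1"
    using cos_angle_Suc[of \<epsilon> q] height_le[of \<epsilon> q] assms cos_tau by simp
  then have "angle \<epsilon> (Suc q) \<noteq> 0" by force
  then show ?thesis using angle_range[of \<epsilon> "Suc q"] assms by simp
qed

lemma continuous_angle: "continuous_on {0..} (\<lambda>\<epsilon>. angle \<epsilon> q)"
proof (induction q)
  case (Suc q)
  have "continuous_on {0..} (\<lambda>\<epsilon>. height \<epsilon> q)"
    unfolding height_def by (intro continuous_intros Suc)
  moreover have "height \<epsilon> q \<le> 1" if "0 \<le> \<epsilon>" for \<epsilon>
    using height_le[OF that, of q] that by simp
  ultimately show ?case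
    unfolding angle_Suc using cos_tau
    by (intro continuous_on_arccos continuous_intros) (auto simp: max_def)
qed simp

lemma continuous_height: "continuous_on {0..} (\<lambda>\<epsilon>. height \<epsilon> q)"
  unfolding height_def by (intro continuous_intros continuous_angle)

lemma height_zero: "height 0 q = 1"
proof -
  have "angle 0 q = 0"
    using cos_tau by (induction q) (simp_all add: max_def)
  then show ?thesis by (simp add: height_def)
qed

lemma edge_gap_exists: "\<exists>\<epsilon>\<ge>0. height \<epsilon> n = cos \<tau>"
proof -
  have "\<exists>\<epsilon>\<ge>0. \<epsilon> \<le> 1 - cos \<tau> \<and> height \<epsilon> n = cos \<tau>"
  proof (rule IVT2')
    show "height (1 - cos \<tau>) n \<le> cos \<tau>" using height_le[of "1 - cos \<tau>" n] cos_tau by simp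
    show "cos \<tau> \<le> height 0 n" using cos_tau by (simp add: height_zero)
    show "continuous_on {0..1 - cos \<tau>} (\<lambda>\<epsilon>. height \<epsilon> n)"
      by (rule continuous_on_subset[OF continuous_height]) auto
  qed (use cos_tau in simp)
  then show ?thesis by blast
qed

text \<open>At this \<open>\<epsilon>\<close> the point number \<open>n\<close> has second coordinate \<open>cos \<tau>\<close>, which contributes nothing to any
\<open>g(j\<kappa>)\<close>; the chain ends there.\<close>

definition edge_gap :: "nat \<Rightarrow> real" where
  "edge_gap n = (SOME \<epsilon>. 0 \<le> \<epsilon> \<and> height \<epsilon> n = cos \<tau>)"

lemma height_edge_gap: "height (edge_gap n) n = cos \<tau>" and edge_gap_pos: "0 < edge_gap n"
proof -
  have *: "0 \<le> edge_gap n \<and> height (edge_gap n) n = cos \<tau>"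
    unfolding edge_gap_def using edge_gap_exists[of n] by (rule someI2_ex)
  then show "height (edge_gap n) n = cos \<tau>" by simp
  have "edge_gap n \<noteq> 0" using * height_zero[of n] cos_tau by auto
  then show "0 < edge_gap n" using * by simp
qed

text \<open>At \<open>\<epsilon> = edge_gap n\<close> the next angle is \<open>\<tau>\<close>, so the next height is \<open>2 cos\<^sup>2 \<tau> - \<epsilon> - cos \<tau>\<close>. This is
below \<open>cos \<tau>\<close>, and a smaller \<open>\<epsilon>\<close> is needed to raise it.\<close>

lemma edge_gap_decreasing: "edge_gap (Suc n) < edge_gap n"
proof (rule ccontr)
  assume "\<not> edge_gap (Suc n) < edge_gap n"
  then have "height (edge_gap (Suc n)) (Suc n) \<le> height (edge_gap n) (Suc n)"
    using height_strict_antimono[of "edge_gap n" "edge_gap (Suc n)" "Suc n"] edge_gap_pos[of n]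
    by (cases "edge_gap n = edge_gap (Suc n)") auto
  moreover have "angle (edge_gap n) (Suc n) = \<tau>"
    unfolding angle_Suc height_edge_gap using tau_pos tau_pi by (simp add: arccos_cos)
  then have "height (edge_gap n) (Suc n) = 1 + cos (2 * \<tau>) - edge_gap n - cos \<tau>"
    by (simp add: height_def)
  ultimately show False
    using cos_tau_square edge_gap_pos[of n] by (simp add: height_edge_gap cos_two_tau)
qed

lemma edge_gap_antimono: "m \<le> n \<Longrightarrow> edge_gap n \<le> edge_gap m"
  by (rule decseqD[OF decseq_SucI]) (simp_all add: edge_gap_decreasing less_imp_le)

lemma height_ge:
  assumes "0 \<le> \<epsilon>" "\<epsilon> \<le> edge_gap n" "q \<le> n"
  shows "cos \<tau> \<le> height \<epsilon> q"
  using height_strict_antimono[of \<epsilon> "edge_gap q" q] assms edge_gap_antimono[OF assms(3)] height_edge_gap[of q]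
  by (cases "\<epsilon> = edge_gap q") auto

lemma chain_step:
  assumes "0 \<le> \<epsilon>" "\<epsilon> \<le> edge_gap n" "q \<le> n"
  shows "cos (angle \<epsilon> (Suc q)) = height \<epsilon> q"
  using cos_angle_Suc[OF assms(1), of q] height_ge[OF assms] by simp

text \<open>The height starts at most at \<open>1 - \<epsilon>\<close>, loses at least \<open>\<epsilon>\<close> in each of \<open>n\<close> further steps and ends at
\<open>cos \<tau>\<close>.\<close>

lemma edge_gap_le: "edge_gap n \<le> (1 - cos \<tau>) / real (Suc n)"
proof -
  have "height (edge_gap n) q \<le> 1 - real (Suc q) * edge_gap n" if "q \<le> n" for q
    using that
  proof (induction q)
    case 0
    then show ?case using height_le[of "edge_gap n" 0] edge_gap_pos[of n] by simp
  next
    case (Suc q)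
    have "height (edge_gap n) (Suc q) \<le> height (edge_gap n) q - edge_gap n"
      using height_le_cos_angle[of "edge_gap n" "Suc q"] chain_step[of "edge_gap n" n q] Suc.prems edge_gap_pos[of n] by simp
    then show ?case using Suc by (simp add: algebra_simps)
  qed
  from this[of n] have "real (Suc n) * edge_gap n \<le> 1 - cos \<tau>" by (simp add: height_edge_gap)
  then show ?thesis by (simp add: field_simps)
qed

text \<open>The first coordinate of the point number \<open>n + 1\<close> is compared with \<open>E/2\<close>. At \<open>\<epsilon> = edge_gap (n + 1)\<close>
the other coordinate is \<open>cos \<tau> > cos\<^sup>2 \<tau> > E/2\<close>, so the first one is too small; at \<open>\<epsilon> = edge_gap n\<close>
the first coordinate is \<open>cos \<tau>\<close> and too large.\<close>

lemma diagonal_gap_exists: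
  "\<exists>\<epsilon>. edge_gap (Suc n) < \<epsilon> \<and> \<epsilon> < edge_gap n \<and> 2 * cos (2 * \<tau> - angle \<epsilon> (Suc n)) = 1 + cos (2 * \<tau>) - \<epsilon>"
proof -
  let ?f = "\<lambda>\<epsilon>. 2 * cos (2 * \<tau> - angle \<epsilon> (Suc n)) - (1 + cos (2 * \<tau>) - \<epsilon>)"
  have lo: "?f (edge_gap (Suc n)) < 0"
    using height_edge_gap[of "Suc n"] edge_gap_pos[of "Suc n"] cos_tau_square
    unfolding height_def cos_two_tau by linarith
  have "angle (edge_gap n) (Suc n) = \<tau>"
    unfolding angle_Suc height_edge_gap using tau_pos tau_pi by (simp add: arccos_cos)
  then have "?f (edge_gap n) = 2 * cos \<tau> - (2 * (cos \<tau>)\<^sup>2 - edge_gap n)"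
    by (simp add: cos_two_tau del: chain_angle.simps)
  then have hi: "0 < ?f (edge_gap n)" using edge_gap_pos[of n] cos_tau_square by linarith
  have "\<exists>\<epsilon>\<ge>edge_gap (Suc n). \<epsilon> \<le> edge_gap n \<and> ?f \<epsilon> = 0"
  proof (rule IVT')
    show "continuous_on {edge_gap (Suc n)..edge_gap n} ?f"
      by (intro continuous_intros continuous_on_subset[OF continuous_angle])
        (use edge_gap_pos[of "Suc n"] in auto)
  qed (use lo hi edge_gap_decreasing[of n] in auto)
  then obtain \<epsilon> where \<epsilon>: "edge_gap (Suc n) \<le> \<epsilon>" "\<epsilon> \<le> edge_gap n" "?f \<epsilon> = 0" by blast
  then have "\<epsilon> \<noteq> edge_gap (Suc n)" "\<epsilon> \<noteq> edge_gap n" using lo hi by (auto simp del: chain_angle.simps)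
  with \<epsilon> show ?thesis by (intro exI[of _ \<epsilon>]) (auto simp del: chain_angle.simps)
qed

text \<open>At this \<open>\<epsilon>\<close> the chain ends with the point number \<open>n + 1\<close> on the diagonal.\<close>

definition diagonal_gap :: "nat \<Rightarrow> real" where
  "diagonal_gap n = (SOME \<epsilon>. edge_gap (Suc n) < \<epsilon> \<and> \<epsilon> < edge_gap n \<and>
     2 * cos (2 * \<tau> - angle \<epsilon> (Suc n)) = 1 + cos (2 * \<tau>) - \<epsilon>)"

lemma diagonal_gap: "edge_gap (Suc n) < diagonal_gap n" "diagonal_gap n < edge_gap n"
  "2 * cos (2 * \<tau> - angle (diagonal_gap n) (Suc n)) = 1 + cos (2 * \<tau>) - diagonal_gap n"
  using someI_ex[OF diagonal_gap_exists[of n]] unfolding diagonal_gap_def[symmetric] by auto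

text \<open>The interlacing \<open>edge_gap 0 > diagonal_gap 0 > edge_gap 1 > diagonal_gap 1 > \<dots>\<close>; from index 1 on,
the members number \<open>2n - 1\<close> and \<open>2n\<close> belong to chains of length \<open>n\<close>.\<close>

definition gap :: "nat \<Rightarrow> real" where
  "gap k = (if even k then edge_gap (k div 2) else diagonal_gap (k div 2))"

lemma gap_pos: "0 < gap k"
  using edge_gap_pos[of "k div 2"] less_trans[OF edge_gap_pos diagonal_gap(1), of "k div 2"] by (auto simp: gap_def)

lemma gap_decreasing: "gap (Suc k) < gap k"
  using diagonal_gap by (auto simp: gap_def elim!: evenE oddE)

lemma gap_le: "gap k \<le> 2 * (1 - cos \<tau>) / real (Suc k)"
proof -
  have "gap k \<le> edge_gap (k div 2)" using diagonal_gap(2) by (auto simp: gap_def less_imp_le)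
  also have "\<dots> \<le> (1 - cos \<tau>) / real (Suc (k div 2))" by (rule edge_gap_le)
  also have "\<dots> \<le> (1 - cos \<tau>) / (real (Suc k) / 2)"
  proof (rule divide_left_mono)
    have "Suc k \<le> 2 * Suc (k div 2)" by presburger
    then have "real (Suc k) \<le> real (2 * Suc (k div 2))" by (rule of_nat_mono)
    then show "real (Suc k) / 2 \<le> real (Suc (k div 2))" by simp
  qed (use cos_tau in auto)
  finally show ?thesis by (simp add: mult.commute)
qed

lemma gap_less:
  assumes "1 \<le> k"
  shows "gap k < 1 - cos \<tau>"
proof -
  have "decseq gap" by (rule decseq_SucI) (rule less_imp_le[OF gap_decreasing])
  then have "gap k \<le> gap 1" using assms by (rule decseqD)
  also have "gap 1 < gap 0" using gap_decreasing[of 0] by simp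
  also have "gap 0 \<le> 1 - cos \<tau>" using edge_gap_le[of 0] by (simp add: gap_def)
  finally show ?thesis .
qed

lemma gap_tendsto: "gap \<longlonglongrightarrow> 0"
proof (rule tendsto_sandwich[OF always_eventually always_eventually tendsto_const])
  show "\<forall>k. gap k \<le> 2 * (1 - cos \<tau>) / real (Suc k)" using gap_le by blast
  show "(\<lambda>k. 2 * (1 - cos \<tau>) / real (Suc k)) \<longlonglongrightarrow> 0"
    by (rule LIMSEQ_Suc[OF lim_const_over_n])
qed (simp add: gap_pos less_imp_le)

lemma threshold:
  assumes \<kappa>: "\<kappa> \<ge> 2" "\<tau> = pi / real \<kappa>"
  shows edge_gap_threshold: "1 + cos (2 * \<tau>) - edge_gap n \<in> Theta_order n \<kappa>"
    and diagonal_gap_threshold: "1 + cos (2 * \<tau>) - diagonal_gap n \<in> Theta_order (Suc n) \<kappa>"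
proof -
  have pos: "0 < angle \<epsilon> q \<and> angle \<epsilon> q \<le> \<tau>" if "0 < \<epsilon>" "0 < q" for \<epsilon> q
    using angle_pos[OF that(1), of "q - 1"] angle_range[of \<epsilon> q] that by simp
  have step: "cos (2 * \<tau> - angle \<epsilon> q) + cos (angle \<epsilon> (Suc q)) = 1 + cos (2 * \<tau>) - \<epsilon>"
    if "0 \<le> \<epsilon>" "\<epsilon> \<le> edge_gap n" "q \<le> n" for \<epsilon> q n
    unfolding chain_step[OF that] by (simp add: height_def)
  show "1 + cos (2 * \<tau>) - edge_gap n \<in> Theta_order n \<kappa>"
  proof (rule chain_threshold[OF \<kappa>, where a = "angle (edge_gap n)"])
    show "cos (2 * \<tau> - angle (edge_gap n) n) + cos \<tau> = 1 + cos (2 * \<tau>) - edge_gap n \<or>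
        2 * cos (2 * \<tau> - angle (edge_gap n) n) = 1 + cos (2 * \<tau>) - edge_gap n"
      using height_edge_gap[of n] by (simp add: height_def)
    show "cos (2 * \<tau> - angle (edge_gap n) q) + cos (angle (edge_gap n) (Suc q)) = 1 + cos (2 * \<tau>) - edge_gap n"
      if "q < n" for q using step[of "edge_gap n" n q] edge_gap_pos[of n] that by linarith
  qed (use pos edge_gap_pos[of n] in simp_all)
  have fn: "0 < diagonal_gap n" "diagonal_gap n \<le> edge_gap n" using diagonal_gap[of n] edge_gap_pos[of "Suc n"] by auto
  show "1 + cos (2 * \<tau>) - diagonal_gap n \<in> Theta_order (Suc n) \<kappa>"
  proof (rule chain_threshold[OF \<kappa>, where a = "angle (diagonal_gap n)"])
    show "cos (2 * \<tau> - angle (diagonal_gap n) (Suc n)) + cos \<tau> = 1 + cos (2 * \<tau>) - diagonal_gap n \<or>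
        2 * cos (2 * \<tau> - angle (diagonal_gap n) (Suc n)) = 1 + cos (2 * \<tau>) - diagonal_gap n"
      using diagonal_gap(3) by blast
    show "cos (2 * \<tau> - angle (diagonal_gap n) q) + cos (angle (diagonal_gap n) (Suc q)) = 1 + cos (2 * \<tau>) - diagonal_gap n"
      if "q < Suc n" for q using step[of "diagonal_gap n" n q] fn that by linarith
  qed (use pos fn in simp_all)
qed

end

theorem theorem1p13:
  fixes \<kappa> :: nat
  assumes "\<kappa> \<ge> 3"
  shows "\<exists>F G :: nat \<Rightarrow> real.
    strict_mono_on {1..} F \<and> strict_mono_on {1..} G \<and>
    (\<forall>n\<ge>1. F n \<in> {cos (pi / \<kappa>) + cos (2 * pi / \<kappa>) <..< 1 + cos (2 * pi / \<kappa>)} \<inter> Theta \<kappa>) \<and>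
    (\<forall>n\<ge>1. G n \<in> {cos (pi / \<kappa>) + cos (2 * pi / \<kappa>) <..< 1 + cos (2 * pi / \<kappa>)} \<inter> Theta \<kappa>) \<and>
    F \<longlonglongrightarrow> 1 + cos (2 * pi / \<kappa>) \<and> G \<longlonglongrightarrow> 1 + cos (2 * pi / \<kappa>) \<and>
    (\<forall>n\<ge>1. F (2 * n - 1) \<in> Theta_order n \<kappa> \<and> F (2 * n) \<in> Theta_order n \<kappa> \<and>
            G (2 * n - 1) \<in> Theta_order n \<kappa> \<and> G (2 * n) \<in> Theta_order n \<kappa>)"
proof -
  define \<tau> where "\<tau> = pi / real \<kappa>"
  interpret angle_chain \<tau>
    by unfold_locales (use assms in \<open>auto simp: \<tau>_def field_simps\<close>)
  have two_tau: "2 * pi / real \<kappa> = 2 * \<tau>" by (simp add: \<tau>_def)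
  define F where "F k = 1 + cos (2 * \<tau>) - gap k" for k
  have \<kappa>: "\<kappa> \<ge> 2" "\<kappa> \<ge> 1" using assms by auto
  have mono: "strict_mono_on {1..} F"
  proof (rule strict_mono_onI)
    fix r s :: nat assume "r < s"
    have "F k < F (Suc k)" for k using gap_decreasing by (simp add: F_def)
    then show "F r < F s" using \<open>r < s\<close> by (rule lift_Suc_mono_less)
  qed
  have lim: "F \<longlonglongrightarrow> 1 + cos (2 * \<tau>)"
    unfolding F_def using tendsto_diff[OF tendsto_const gap_tendsto, of "1 + cos (2 * \<tau>)"] by simp
  have order: "F (2 * n - 1) \<in> Theta_order n \<kappa>" "F (2 * n) \<in> Theta_order n \<kappa>" if n: "n \<ge> 1" for n
  proof -
    obtain m where m: "n = Suc m" using n by (cases n) auto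
    have "F (2 * n - 1) = 1 + cos (2 * \<tau>) - diagonal_gap m" by (simp add: F_def gap_def m)
    then show "F (2 * n - 1) \<in> Theta_order n \<kappa>" using diagonal_gap_threshold[OF \<kappa>(1) \<tau>_def] m by simp
    have "F (2 * n) = 1 + cos (2 * \<tau>) - edge_gap n" by (simp add: F_def gap_def)
    then show "F (2 * n) \<in> Theta_order n \<kappa>" using edge_gap_threshold[OF \<kappa>(1) \<tau>_def] by simp
  qed
  have "F n \<in> {cos \<tau> + cos (2 * \<tau>) <..< 1 + cos (2 * \<tau>)} \<inter> Theta \<kappa>" if n: "n \<ge> 1" for n
  proof
    show "F n \<in> {cos \<tau> + cos (2 * \<tau>) <..< 1 + cos (2 * \<tau>)}"
      using gap_pos[of n] gap_less[OF n] by (simp add: F_def)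
    obtain m where "F n \<in> Theta_order m \<kappa>"
    proof (cases "even n")
      case True
      then show thesis using order(2)[of "n div 2"] n that by auto
    next
      case False
      then have "2 * Suc (n div 2) - 1 = n" by (auto elim: oddE)
      then show thesis using order(1)[of "Suc (n div 2)"] that by simp
    qed
    then show "F n \<in> Theta \<kappa>" using Theta_order_subset_Theta[OF \<kappa>(2)] by blast
  qed
  then have "\<forall>n\<ge>1. F n \<in> {cos \<tau> + cos (2 * \<tau>) <..< 1 + cos (2 * \<tau>)} \<inter> Theta \<kappa>"
    by blast
  moreover have "\<forall>n\<ge>1. F (2 * n - 1) \<in> Theta_order n \<kappa> \<and> F (2 * n) \<in> Theta_order n \<kappa> \<and>
      F (2 * n - 1) \<in> Theta_order n \<kappa> \<and> F (2 * n) \<in> Theta_order n \<kappa>"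
    using order by blast
  ultimately show ?thesis
    unfolding two_tau \<tau>_def[symmetric] using mono lim by (intro exI[of _ F] conjI)
qed

end
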